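(* Let $m$ and $n$ be positive integers with $n\le m\le \binom{2n}{2}$. Then: (1) For every $G=(V,E)\in\mathcal{G}(2n,m)$, $$\prod_{v\in V}(\deg(v)!)^{\frac{1}{2\deg(v)}}\le \omega(2n,m),$$ and equality holds if and only if $G$ is almost regular. (2) $\mu(2n,m)\le \omega(2n,m)$. Equality $\mu(2n,m)=\omega(2n,m)$ holds if and only if $\mathcal{G}(2n,m)$ contains a graph $G^\star$ which is a disjoint union of $\ell_1\ge 1$ copies of $K_{n_1,n_1}$ and $\ell_2\ge 0$ copies of $K_{n_1+1,n_1+1}$ for some positive integer $n_1$ and integers $\ell_1\ge 1$, $\ell_2\ge 0$; i.e. $n=\ell_1n_1+\ell_2(n_1+1)$ and $m=\ell_1n_1^2+\ell_2(n_1+1)^2$. (3) For such values of $n$ and $m$, the graph in $\mathcal{G}(2n,m)$ whose number of perfect matchings equals $\mu(2n,m)$ is unique up to isomorphism, and it is the disjoint union $\ell_1K_{n_1,n_1}\cup \ell_2K_{n_1+1,n_1+1}$.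
   Context: $\mathcal{G}(2n,m)$ is the set of all simple graphs with $2n$ vertices and $m$ edges. $\deg(v)$ is the degree of the vertex $v$. ${\rm perfmat}\,G$ is the number of perfect matchings of $G$, and $\mu(2n,m):=\max_{G\in\mathcal{G}(2n,m)}{\rm perfmat}\,G$. $K_{r,r}$ is the complete bipartite graph with both parts of size $r$. A graph is almost regular if $|\deg(u)-\deg(v)|\le 1$ for all vertices $u,v$. Define $$\omega(2n,m):=\left(\lfloor \tfrac{m}{n}\rfloor !\right)^{\frac{n-\alpha}{\lfloor m/n\rfloor}}\left(\lceil \tfrac{m}{n}\rceil !\right)^{\frac{\alpha}{\lceil m/n\rceil}},\qquad \alpha:=m-n\lfloor \tfrac{m}{n}\rfloor .$$ Convention: for a vertex of degree $0$ the factor $(0!)^{1/0}$ (or $(0!)^{1/(2\cdot 0)}$) is interpreted as $0$. *)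

theory Defs
  imports Complex_Main "HOL-Library.Ramsey"
begin

type_synonym 'a sgraph = "'a set \<times> 'a set set"

abbreviation verts :: "'a sgraph \<Rightarrow> 'a set" where "verts \<equiv> fst"
abbreviation edges :: "'a sgraph \<Rightarrow> 'a set set" where "edges \<equiv> snd"

definition simple_graphs :: "nat \<Rightarrow> nat \<Rightarrow> 'a sgraph set" where
  "simple_graphs N m =
     {G. finite (verts G) \<and> card (verts G) = N \<and> edges G \<subseteq> nsets (verts G) 2 \<and> card (edges G) = m}"

definition degree :: "'a sgraph \<Rightarrow> 'a \<Rightarrow> nat" where
  "degree G v = card {e \<in> edges G. v \<in> e}"

definition almost_regular :: "'a sgraph \<Rightarrow> bool" where
  "almost_regular G \<longleftrightarrow>
     (\<forall>u\<in>verts G. \<forall>v\<in>verts G. \<bar>int (degree G u) - int (degree G v)\<bar> \<le> 1)"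

definition perfect_matching :: "'a sgraph \<Rightarrow> 'a set set \<Rightarrow> bool" where
  "perfect_matching G M \<longleftrightarrow> M \<subseteq> edges G \<and> (\<forall>v\<in>verts G. \<exists>!e. e \<in> M \<and> v \<in> e)"

definition perfmat :: "'a sgraph \<Rightarrow> nat" where
  "perfmat G = card {M. perfect_matching G M}"

definition graph_iso :: "'a sgraph \<Rightarrow> 'b sgraph \<Rightarrow> bool" where
  "graph_iso G H \<longleftrightarrow>
     (\<exists>f. bij_betw f (verts G) (verts H) \<and> edges H = (\<lambda>e. f ` e) ` edges G)"

definition complete_bipartite :: "nat \<Rightarrow> nat \<Rightarrow> (nat + nat) sgraph" where
  "complete_bipartite r s = ({..<r} <+> {..<s}, {{Inl i, Inr j} | i j. i < r \<and> j < s})"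

definition disjoint_union :: "'a sgraph \<Rightarrow> 'b sgraph \<Rightarrow> ('a + 'b) sgraph" where
  "disjoint_union G H =
     (verts G <+> verts H, (\<lambda>e. Inl ` e) ` edges G \<union> (\<lambda>e. Inr ` e) ` edges H)"

definition copies :: "nat \<Rightarrow> 'a sgraph \<Rightarrow> (nat \<times> 'a) sgraph" where
  "copies l G = ({..<l} \<times> verts G, \<Union>i<l. (\<lambda>e. Pair i ` e) ` edges G)"

definition bipartite_union :: "nat \<Rightarrow> nat \<Rightarrow> nat \<Rightarrow> (nat \<times> (nat + nat) + nat \<times> (nat + nat)) sgraph" where
  "bipartite_union l1 l2 r =
     disjoint_union (copies l1 (complete_bipartite r r))
                    (copies l2 (complete_bipartite (r + 1) (r + 1)))"

text \<open>The factor (d!)^(1/(2d)) of a vertex of degree d. The value at d = 0 has to be set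
  explicitly: with division by zero equal to zero, the formula would give 1 there.\<close>

definition degree_factor :: "nat \<Rightarrow> real" where
  "degree_factor d = (if d = 0 then 0 else fact d powr (1 / (2 * real d)))"

text \<open>Both \<open>mu n m\<close> and \<open>omega n m\<close> refer to graphs on 2n vertices. In \<open>mu\<close>, vertices
  are taken from the natural numbers, which covers all finite graphs up to isomorphism. The set of
  graphs is then infinite, but the set of values whose maximum is taken is finite.\<close>

definition mu :: "nat \<Rightarrow> nat \<Rightarrow> nat" where
  "mu n m = Max (perfmat ` (simple_graphs (2 * n) m :: nat sgraph set))"

lemma finite_perfmat_image: "finite (perfmat ` (simple_graphs N m :: 'a sgraph set))"
proof (rule finite_subset)
  show "perfmat ` (simple_graphs N m :: 'a sgraph set) \<subseteq> {..2 ^ m}"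
  proof (rule image_subsetI)
    fix G :: "'a sgraph"
    assume G: "G \<in> simple_graphs N m"
    then have "edges G \<subseteq> Pow (verts G)" and "finite (verts G)"
      by (auto simp: simple_graphs_def nsets_def)
    then have fin: "finite (edges G)"
      by (meson finite_Pow_iff finite_subset)
    have "{M. perfect_matching G M} \<subseteq> Pow (edges G)"
      by (auto simp: perfect_matching_def)
    then have "perfmat G \<le> card (Pow (edges G))"
      unfolding perfmat_def using fin by (intro card_mono) auto
    then show "perfmat G \<in> {..2 ^ m}"
      using G fin by (simp add: card_Pow simple_graphs_def)
  qed
qed simp

definition omega :: "nat \<Rightarrow> nat \<Rightarrow> real" where
  "omega n m =
     (let a = nat \<lfloor>real m / real n\<rfloor>; b = nat \<lceil>real m / real n\<rceil>; \<alpha> = real m - real n * real a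
      in fact a powr ((real n - \<alpha>) / real a) * fact b powr (\<alpha> / real b))"

end

(*
  The union of two perfect matchings consists of single edges and even cycles, so pairs of perfect
  matchings embed into the permutations of the vertices that follow edges:
  perfmat G ^ 2 <= per(A) for the adjacency matrix A.  Bregman's inequality
  per(A) <= prod_v (deg v)!^(1 / deg v), proved by Schrijver's induction over minors, then bounds
  perfmat G by the product of the degree factors, and strict concavity of ln (d!) / d bounds that
  product by omega.  Equality in Schrijver's induction forces any two rows of A to have equal or
  disjoint supports; as A is symmetric with zero diagonal, G is then a union of balanced complete
  bipartite graphs, and almost regularity leaves only two consecutive sizes.
*)

theory Submission
  imports Defs "HOL-Combinatorics.Permutations"
begin

section \<open>Concavity of ln (d!) / d\<close>

text \<open>Logarithms turn all products into sums of \<open>ln_fact_root\<close> values. Tightness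
  in Schrijver's induction makes ln r - ln ((r-1)!) / (r-1), for a row of size r, depend only on the
  column at which the row is expanded. This quantity is \<open>ln_fact_root_gap\<close>; its strict
  growth forces rows that meet to have equal size. As a mean of the increasing numbers
  \<open>slope j\<close>, it also yields the concavity.

  The obstacle in the matching step is that an even cycle has two directions, and the permutation
  must still reveal which of its edges belong to which matching. The direction is therefore tied to
  the vertex set of the component: its least vertex, in a fixed numbering, moves along the first
  matching.

  Equal or disjoint supports alone would allow unbalanced complete bipartite components; balance
  comes from the existence of a permutation that follows edges. For the extremal graphs only a lower
  bound on the number of matchings has to be counted, because the general upper bound already has
  the same value.\<close>

definition ln_fact_root :: "nat \<Rightarrow> real" where
  "ln_fact_root d = ln (fact d) / real d"

lemma real_mult_lf: "real d * ln_fact_root d = ln (fact d)"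
  by (simp add: ln_fact_root_def)

lemma ln_fact_Suc: "ln (fact (Suc d) :: real) = ln (real (Suc d)) + ln (fact d)"
  by (simp add: ln_mult del: of_nat_Suc)

lemma ln_less_minus_one:
  fixes x :: real
  assumes "0 < x" "x \<noteq> 1" shows "ln x < x - 1"
  using ln_le_minus_one[of x] ln_eq_minus_one[of x] assms by (auto simp: less_le)

text \<open>For j > 0 this is j (ln (j+1) - ln j), the j-th increment of d ln (d+1) - ln (d!), which
  is \<open>real d * ln_fact_root_gap (Suc d)\<close>.\<close>

definition slope :: "nat \<Rightarrow> real" where
  "slope j = real j * ln (1 + 1 / real j)"

text \<open>In Bregman's induction ln r comes from averaging over the r minors of a row, and
  \<open>ln_fact_root (r - 1)\<close> from that row within a minor. At r = 1 the value is 0, because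
  division by zero makes \<open>ln_fact_root 0\<close> zero.\<close>

definition ln_fact_root_gap :: "nat \<Rightarrow> real" where
  "ln_fact_root_gap r = ln (real r) - ln_fact_root (r - 1)"

text \<open>The two logarithms differ by ln (1 + 1/(x(x+2))) < 1/(x(x+2)). Multiplied by x this
  stays below 1/(x+2), which is less than ln (1 + 1/(x+1)), the extra summand on the right.\<close>

lemma slope_strict_mono: "0 < j \<Longrightarrow> slope j < slope (Suc j)"
proof -
  assume j: "0 < j"
  define x where "x = real j"
  have x: "0 < x" using j by (simp add: x_def)
  have "x * ln (1 + 1 / x) < (x + 1) * ln (1 + 1 / (x + 1))"
  proof -
    have "0 < (1 + 1/x) / (1 + 1/(x+1))"
      using x by (intro divide_pos_pos add_pos_pos) auto
    then have a: "ln ((1 + 1/x) / (1 + 1/(x+1))) < (1 + 1/x) / (1 + 1/(x+1)) - 1"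
      using x by (intro ln_less_minus_one) (auto simp: field_simps)
    have b: "(1 + 1/x) / (1 + 1/(x+1)) - 1 = 1 / (x * (x + 2))"
    proof -
      have "(1 + 1/x) / (1 + 1/(x+1)) = (x + 1)\<^sup>2 / (x * (x + 2))"
        using x by (simp add: divide_simps power2_eq_square)
      moreover have "(x + 1)\<^sup>2 = x * (x + 2) + 1" by (simp add: power2_eq_square algebra_simps)
      ultimately show ?thesis using x by (simp add: add_divide_distrib)
    qed
    have c: "ln ((1 + 1/x) / (1 + 1/(x+1))) = ln (1 + 1/x) - ln (1 + 1/(x+1))"
      using ln_div[of "1 + 1/x" "1 + 1/(x+1)"] add_pos_pos[of 1 "1/x"] add_pos_pos[of 1 "1/(x+1)"] x
      by simp
    have "ln (1 / (1 + 1/(x+1))) < 1 / (1 + 1/(x+1)) - 1"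
      using x by (intro ln_less_minus_one) (auto simp: field_simps)
    moreover have "ln (1 / (1 + 1/(x+1))) = - ln (1 + 1/(x+1))"
      using x ln_div[of 1 "1 + 1/(x+1)"] add_pos_pos[of 1 "1/(x+1)"] by simp
    moreover have "1 / (1 + 1/(x+1)) - 1 = - (1 / (x + 2))"
      using x by (simp add: field_simps)
    ultimately have d: "1 / (x + 2) < ln (1 + 1/(x+1))" by linarith
    have "x * (ln (1 + 1/x) - ln (1 + 1/(x+1))) < x * (1 / (x * (x + 2)))"
      using a b c x by (intro mult_strict_left_mono) auto
    also have "\<dots> = 1 / (x + 2)" using x by simp
    finally show ?thesis using d by (simp add: algebra_simps)
  qed
  then show ?thesis by (simp add: slope_def x_def algebra_simps)
qed

text \<open>Telescoping. It exhibits \<open>ln_fact_root_gap (Suc d)\<close> as the mean of the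
  first d slopes.\<close>

lemma ln_fact_root_gap_Suc: "real d * ln_fact_root_gap (Suc d) = (\<Sum>j = 1..d. slope j)"
proof (induction d)
  case (Suc d)
  have "real (Suc d) * ln_fact_root_gap (Suc (Suc d)) = real (Suc d) * ln (real (Suc (Suc d))) - ln (fact (Suc d))"
    by (simp add: ln_fact_root_gap_def right_diff_distrib real_mult_lf del: of_nat_Suc fact_Suc)
  moreover have "real d * ln_fact_root_gap (Suc d) = real d * ln (real (Suc d)) - ln (fact d)"
    by (simp add: ln_fact_root_gap_def right_diff_distrib real_mult_lf del: of_nat_Suc fact_Suc)
  moreover have "slope (Suc d) = real (Suc d) * (ln (real (Suc (Suc d))) - ln (real (Suc d)))"
  proof -
    have "1 + 1 / real (Suc d) = real (Suc (Suc d)) / real (Suc d)" by (simp add: field_simps)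
    then show ?thesis by (simp add: slope_def ln_div del: of_nat_Suc)
  qed
  ultimately show ?case using Suc
    by (simp add: ln_fact_Suc algebra_simps del: of_nat_Suc fact_Suc) (simp add: algebra_simps)
qed simp

lemma slope_mono:
  assumes "0 < i" "i \<le> j" shows "slope i \<le> slope j"
  using assms(2)
proof (induction rule: dec_induct)
  case (step k)
  then show ?case using slope_strict_mono[of k] assms by linarith
qed simp

lemma ln_fact_root_gap_less_slope: 
  assumes "0 < d" shows "ln_fact_root_gap (Suc d) < slope (Suc d)"
proof -
  have "slope j < slope (Suc d)" if "j \<in> {1..d}" for j
    using slope_mono[of j d] slope_strict_mono[of d] assms that by auto
  then have "(\<Sum>j = 1..d. slope j) < (\<Sum>j = 1..d. slope (Suc d))"
    using assms by (intro sum_strict_mono) auto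
  then have "real d * ln_fact_root_gap (Suc d) < real d * slope (Suc d)"
    by (simp add: ln_fact_root_gap_Suc)
  then show ?thesis using assms by simp
qed

text \<open>A mean grows when a term larger than all previous ones joins. The case r = 1, a mean of
  no terms, is computed directly.\<close>

lemma ln_fact_root_gap_strict_mono_Suc:
  assumes "0 < r" shows "ln_fact_root_gap r < ln_fact_root_gap (Suc r)"
proof (cases "r = 1")
  case False
  then obtain d where d: "r = Suc d" "0 < d" using assms by (cases r) auto
  have "real (Suc d) * ln_fact_root_gap (Suc (Suc d)) = real d * ln_fact_root_gap (Suc d) + slope (Suc d)"
    using ln_fact_root_gap_Suc[of d] ln_fact_root_gap_Suc[of "Suc d"] by simp
  then have "real (Suc d) * ln_fact_root_gap (Suc d) < real (Suc d) * ln_fact_root_gap (Suc (Suc d))"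
    using ln_fact_root_gap_less_slope[OF d(2)] by (simp add: algebra_simps)
  then show ?thesis using d by simp
qed (simp add: ln_fact_root_gap_def ln_fact_root_def)

lemma ln_fact_root_gap_inj:
  assumes "0 < r" "0 < s" "ln_fact_root_gap r = ln_fact_root_gap s" shows "r = s"
proof -
  have "strict_mono (\<lambda>k. ln_fact_root_gap (Suc k))"
    by (simp add: strict_mono_Suc_iff ln_fact_root_gap_strict_mono_Suc)
  from strict_mono_eq[OF this, of "r - 1" "s - 1"] show ?thesis using assms by simp
qed

lemma ln_fact_root_step: "ln_fact_root (Suc d) - ln_fact_root d = ln_fact_root_gap (Suc d) / real (Suc d)"
  using real_mult_lf[of "Suc d"] real_mult_lf[of d] ln_fact_Suc[of d]
  by (simp add: ln_fact_root_gap_def field_simps)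

text \<open>By the recursion for means the claim reduces to
  \<open>slope (Suc d) < 2 * ln_fact_root_gap (Suc d)\<close>, where the left side is below 1 and
  the right side at least 2 ln 2 > 1. At d = 0 it fails: the values at 0, 1, 2 are 0, 0, (ln 2)/2,
  so concavity begins at 1.\<close>

lemma ln_fact_root_step_strict_antimono:
  assumes "0 < d" shows "ln_fact_root (Suc (Suc d)) - ln_fact_root (Suc d) < ln_fact_root (Suc d) - ln_fact_root d"
proof -
  have h: "1 / 2 < ln (2 :: real)"
    using ln_less_minus_one[of "1/2 :: real"] by (simp add: ln_div)
  have "(\<Sum>j = 1..d. ln 2) \<le> (\<Sum>j = 1..d. slope j)"
    using slope_mono[of 1] by (intro sum_mono) (auto simp: slope_def)
  then have g: "ln 2 \<le> ln_fact_root_gap (Suc d)"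
    using assms by (simp flip: ln_fact_root_gap_Suc del: One_nat_def)
  have "slope (Suc d) < 1"
  proof -
    have "slope (Suc d) < real (Suc d) * (1 / real (Suc d))"
      unfolding slope_def using ln_less_minus_one[of "1 + 1 / real (Suc d)"] add_pos_pos[of 1 "1 / real (Suc d)"]
      by (intro mult_strict_left_mono) (auto simp del: of_nat_Suc)
    then show ?thesis by simp
  qed
  moreover have "real (Suc d) * ln_fact_root_gap (Suc (Suc d)) = real d * ln_fact_root_gap (Suc d) + slope (Suc d)"
    using ln_fact_root_gap_Suc[of d] ln_fact_root_gap_Suc[of "Suc d"] by simp
  ultimately have "real (Suc d) * ln_fact_root_gap (Suc (Suc d)) < real (Suc (Suc d)) * ln_fact_root_gap (Suc d)"
    using g h by (simp add: algebra_simps)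
  then show ?thesis
    unfolding ln_fact_root_step by (simp add: field_simps)
qed

text \<open>The line is the secant through a and \<open>Suc a\<close>. Strictly decreasing
  increments put every other positive integer strictly below it. The two touching points are the
  reason why equality later means almost regular and not regular.\<close>

lemma ln_fact_root_tangent:
  assumes "0 < a" "0 < d"
  shows "ln_fact_root d \<le> ln_fact_root a + (real d - real a) * (ln_fact_root (Suc a) - ln_fact_root a)"
    and "ln_fact_root d = ln_fact_root a + (real d - real a) * (ln_fact_root (Suc a) - ln_fact_root a) \<Longrightarrow> d = a \<or> d = Suc a"
proof -
  define s where "s i = ln_fact_root (Suc i) - ln_fact_root i" for i
  have anti: "s (Suc i) < s i" if "0 < i" for i
    using ln_fact_root_step_strict_antimono[OF that] by (simp add: s_def)
  have mono: "s j < s i" if "0 < i" "i < j" for i j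
    using that(2,1) by (induction rule: strict_inc_induct) (auto dest: anti intro: less_trans)
  \<comment> \<open>Here k = 0 is the second touching point, so strictness starts at k = 1. To the
    left it holds at once, and \<open>Suc k < a\<close> keeps the argument positive.\<close>
  have up: "ln_fact_root (a + Suc k) \<le> ln_fact_root a + real (Suc k) * s a \<and>
    (0 < k \<longrightarrow> ln_fact_root (a + Suc k) < ln_fact_root a + real (Suc k) * s a)" for k
  proof (induction k)
    case (Suc k)
    have "ln_fact_root (a + Suc (Suc k)) = ln_fact_root (a + Suc k) + s (a + Suc k)" by (simp add: s_def)
    moreover have "s (a + Suc k) < s a" using assms by (intro mono) auto
    ultimately show ?case using Suc by (simp add: algebra_simps)
  qed (simp add: s_def)
  have down: "ln_fact_root (a - Suc k) < ln_fact_root a - real (Suc k) * s a" if "Suc k < a" for k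
    using that
  proof (induction k)
    case 0
    then have "ln_fact_root a = ln_fact_root (a - Suc 0) + s (a - Suc 0)" by (simp add: s_def)
    moreover have "s a < s (a - Suc 0)" using 0 by (intro mono) auto
    ultimately show ?case by simp
  next
    case (Suc k)
    then have "ln_fact_root (a - Suc k) = ln_fact_root (a - Suc (Suc k)) + s (a - Suc (Suc k))"
      by (simp add: s_def Suc_diff_Suc)
    moreover have "s a < s (a - Suc (Suc k))" using Suc.prems by (intro mono) auto
    ultimately show ?case using Suc by (simp add: algebra_simps)
  qed
  consider "d = a" | k where "d = a + Suc k" | k where "Suc k < a" "d = a - Suc k"
  proof -
    consider "d = a" | "a < d" | "d < a" by linarith
    then show ?thesis
    proof cases
      case 2 then show ?thesis using that(2)[of "d - a - 1"] by simp
    next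
      case 3 then show ?thesis using that(3)[of "a - d - 1"] assms by simp
    qed (use that in blast)
  qed
  then have "ln_fact_root d \<le> ln_fact_root a + (real d - real a) * s a \<and>
    (ln_fact_root d = ln_fact_root a + (real d - real a) * s a \<longrightarrow> d = a \<or> d = Suc a)"
  proof cases
    case (2 k)
    with up[of k] show ?thesis by (cases k) auto
  next
    case (3 k)
    then have "real d - real a = - real (Suc k)" by (simp add: of_nat_diff)
    moreover have "ln_fact_root d < ln_fact_root a - real (Suc k) * s a" using down[of k] 3 by simp
    ultimately have "ln_fact_root d < ln_fact_root a + (real d - real a) * s a"
      by (simp only: mult_minus_left add_uminus_conv_diff)
    then show ?thesis by simp
  qed auto
  then show "ln_fact_root d \<le> ln_fact_root a + (real d - real a) * (ln_fact_root (Suc a) - ln_fact_root a)"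
    "ln_fact_root d = ln_fact_root a + (real d - real a) * (ln_fact_root (Suc a) - ln_fact_root a) \<Longrightarrow> d = a \<or> d = Suc a"
    by (auto simp: s_def)
qed

section \<open>Bregman's inequality and its equality case\<close>

text \<open>Its cardinality is the permanent of the 0-1 matrix with rows R, columns C and row
  supports \<open>N i \<inter> C\<close>. A minor shrinks R and C while N stays fixed, which suits
  the induction.\<close>

definition placements :: "'a set \<Rightarrow> 'b set \<Rightarrow> ('a \<Rightarrow> 'b set) \<Rightarrow> ('a \<Rightarrow> 'b) set" where
  "placements R C N = {\<sigma> \<in> extensional R. bij_betw \<sigma> R C \<and> (\<forall>i\<in>R. \<sigma> i \<in> N i)}"

lemma finite_placements: "finite R \<Longrightarrow> finite C \<Longrightarrow> finite (placements R C N)"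
  by (rule finite_subset[OF _ finite_PiE[of R "\<lambda>_. C"]])
    (auto simp: placements_def PiE_def bij_betw_def)

text \<open>The expansion of a permanent along row i, as a bijection.\<close>

lemma bij_betw_placements_minor:
  assumes "i \<in> R" "k \<in> N i \<inter> C"
  shows "bij_betw (\<lambda>\<sigma>. restrict \<sigma> (R - {i})) {\<sigma> \<in> placements R C N. \<sigma> i = k}
    (placements (R - {i}) (C - {k}) N)"
proof (rule bij_betw_byWitness[where f' = "\<lambda>\<tau>. \<tau>(i := k)"])
  show "\<forall>\<sigma>\<in>{\<sigma> \<in> placements R C N. \<sigma> i = k}. (restrict \<sigma> (R - {i}))(i := k) = \<sigma>"
    by (auto simp: placements_def fun_eq_iff extensional_def)
  show "\<forall>\<tau>\<in>placements (R - {i}) (C - {k}) N. restrict (\<tau>(i := k)) (R - {i}) = \<tau>"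
    by (auto simp: placements_def fun_eq_iff extensional_def)
  show "(\<lambda>\<sigma>. restrict \<sigma> (R - {i})) ` {\<sigma> \<in> placements R C N. \<sigma> i = k}
      \<subseteq> placements (R - {i}) (C - {k}) N"
  proof (rule image_subsetI)
    fix \<sigma> assume s: "\<sigma> \<in> {\<sigma> \<in> placements R C N. \<sigma> i = k}"
    then have "bij_betw \<sigma> (R - {i}) (C - {\<sigma> i})"
      using assms by (intro bij_betw_DiffI) (auto simp: placements_def bij_betw_def)
    then have "bij_betw (restrict \<sigma> (R - {i})) (R - {i}) (C - {k})"
      using s bij_betw_cong[of "R - {i}" "restrict \<sigma> (R - {i})" \<sigma>] by simp
    with s show "restrict \<sigma> (R - {i}) \<in> placements (R - {i}) (C - {k}) N"
      by (simp add: placements_def)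
  qed
  show "(\<lambda>\<tau>. \<tau>(i := k)) ` placements (R - {i}) (C - {k}) N \<subseteq> {\<sigma> \<in> placements R C N. \<sigma> i = k}"
  proof (rule image_subsetI)
    fix \<tau> assume t: "\<tau> \<in> placements (R - {i}) (C - {k}) N"
    then have "bij_betw (\<tau>(i := k)) (R - {i}) (C - {k})"
      using bij_betw_cong[of "R - {i}" "\<tau>(i := k)" \<tau>] by (simp add: placements_def)
    then have "bij_betw (\<tau>(i := k)) (insert i (R - {i})) (insert k (C - {k}))"
      using notIn_Un_bij_betw[of i "R - {i}" "\<tau>(i := k)" "C - {k}"] by simp
    with t assms show "\<tau>(i := k) \<in> {\<sigma> \<in> placements R C N. \<sigma> i = k}"
      by (auto simp: placements_def extensional_def insert_absorb)
  qed
qed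

lemma card_placements_fiber:
  assumes "i \<in> R" "k \<in> N i \<inter> C"
  shows "card {\<sigma> \<in> placements R C N. \<sigma> i = k} = card (placements (R - {i}) (C - {k}) N)"
  using bij_betw_same_card[OF bij_betw_placements_minor[of i R k N C]] assms by blast

lemma placements_value:
  assumes "\<sigma> \<in> placements R C N" "i \<in> R" shows "\<sigma> i \<in> N i \<inter> C"
  using assms by (auto simp: placements_def bij_betw_def)

text \<open>A weighted row expansion. The weight 1 gives the permanent itself; the logarithm of the
  minor as weight turns a sum of t ln t over a row into a sum over placements.\<close>

lemma sum_over_placements:
  fixes h :: "'b \<Rightarrow> real"
  assumes "finite R" "finite C" "i \<in> R"
  shows "(\<Sum>\<sigma>\<in>placements R C N. h (\<sigma> i)) =
    (\<Sum>k\<in>N i \<inter> C. real (card (placements (R - {i}) (C - {k}) N)) * h k)"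
proof -
  have "(\<Sum>\<sigma>\<in>placements R C N. h (\<sigma> i)) =
      (\<Sum>k\<in>N i \<inter> C. \<Sum>\<sigma>\<in>{\<sigma> \<in> placements R C N. \<sigma> i = k}. h (\<sigma> i))"
    using assms placements_value[of _ R C N i]
    by (intro sum.group[symmetric] finite_placements) auto
  also have "\<dots> = (\<Sum>k\<in>N i \<inter> C. real (card (placements (R - {i}) (C - {k}) N)) * h k)"
    using assms by (intro sum.cong) (auto simp: card_placements_fiber)
  finally show ?thesis .
qed

text \<open>Jensen's inequality for x ln x with its equality case. It follows termwise from ln x <=
  x - 1 at x = T / (c t k): the upper bounds v sum to 0. A term with t k = 0 contributes 0 on the
  left against T / c, so it is strict, as the equality case requires.\<close>

lemma sum_x_ln_x_ge:
  fixes t :: "'b \<Rightarrow> real"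
  assumes "finite K" "K \<noteq> {}" "\<And>k. k \<in> K \<Longrightarrow> 0 \<le> t k" and T: "T = (\<Sum>k\<in>K. t k)" "0 < T"
  shows "T * ln T \<le> T * ln (real (card K)) + (\<Sum>k\<in>K. t k * ln (t k))"
    and "T * ln T = T * ln (real (card K)) + (\<Sum>k\<in>K. t k * ln (t k)) \<Longrightarrow>
      k \<in> K \<Longrightarrow> t k = T / real (card K)"
proof -
  define c where "c = real (card K)"
  have c: "0 < c" using assms by (simp add: c_def card_gt_0_iff)
  define u where "u k = t k * (ln T - ln c - ln (t k))" for k
  define v where "v k = T / c - t k" for k
  have uv: "u k \<le> v k \<and> (t k \<noteq> T / c \<longrightarrow> u k < v k)" if "k \<in> K" for k
  proof (cases "t k = 0")
    case True
    then show ?thesis using c T(2) by (simp add: u_def v_def)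
  next
    case False
    then have t: "0 < t k" using assms(3)[OF that] by simp
    define x where "x = T / (c * t k)"
    have x: "0 < x" using t c T(2) by (simp add: x_def)
    have l: "ln x = ln T - ln c - ln (t k)"
      using t c T(2) by (simp add: x_def ln_div ln_mult)
    have v: "v k = t k * (x - 1)" using t c by (simp add: v_def x_def field_simps)
    have "ln x \<le> x - 1" using x by (rule ln_le_minus_one)
    moreover have "ln x < x - 1" if "t k \<noteq> T / c"
      using that t c by (intro ln_less_minus_one x) (auto simp: x_def field_simps)
    ultimately show ?thesis using t by (auto simp: v u_def simp flip: l)
  qed
  have sv: "sum v K = 0" using c by (simp add: v_def sum_subtractf T(1)[symmetric] flip: c_def)
  have su: "sum u K = T * ln T - T * ln c - (\<Sum>k\<in>K. t k * ln (t k))"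
    unfolding u_def right_diff_distrib sum_subtractf T(1) sum_distrib_right ..
  have "sum u K \<le> sum v K" using uv by (intro sum_mono) auto
  then show "T * ln T \<le> T * ln (real (card K)) + (\<Sum>k\<in>K. t k * ln (t k))"
    using su sv by (simp add: c_def)
  assume eq: "T * ln T = T * ln (real (card K)) + (\<Sum>k\<in>K. t k * ln (t k))" and k: "k \<in> K"
  show "t k = T / real (card K)"
  proof (rule ccontr)
    assume "t k \<noteq> T / real (card K)"
    then have "sum u K < sum v K"
      using uv k assms(1) by (intro sum_strict_mono_ex1) (auto simp: c_def)
    then show False using su sv eq by (simp add: c_def)
  qed
qed

text \<open>Double counting that makes the sum independent of \<sigma>. A row j of size r loses a
  column for exactly r - 1 of the rows i other than j and is unchanged for the remaining |R| - r. As
  d \<open>ln_fact_root d\<close> = ln (d!), its contributions add up to |R|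
  \<open>ln_fact_root r\<close> - ln r, and the term i = j supplies the missing ln r.\<close>

lemma placements_degree_sum:
  assumes "finite R" "finite C" "\<sigma> \<in> placements R C N"
  shows "(\<Sum>i\<in>R. ln (real (card (N i \<inter> C))) + (\<Sum>j\<in>R - {i}. ln_fact_root (card (N j \<inter> (C - {\<sigma> i}))))) =
    real (card R) * (\<Sum>j\<in>R. ln_fact_root (card (N j \<inter> C)))"
proof -
  have bij: "bij_betw \<sigma> R C" using assms by (simp add: placements_def)
  have row: "(\<Sum>i\<in>R - {j}. ln_fact_root (card (N j \<inter> (C - {\<sigma> i})))) =
      real (card R) * ln_fact_root (card (N j \<inter> C)) - ln (real (card (N j \<inter> C)))" if j: "j \<in> R" for j
  proof -
    define r where "r = card (N j \<inter> C)"
    have "\<sigma> j \<in> N j \<inter> C" using placements_value[OF assms(3) j] .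
    then obtain q where q: "r = Suc q"
      using assms(2) unfolding r_def by (metis card_gt_0_iff empty_iff finite_Int gr0_implies_Suc)
    define B where "B = {i \<in> R. \<sigma> i \<in> N j}"
    have "bij_betw \<sigma> B (N j \<inter> C)"
      using bij by (auto simp: B_def bij_betw_def inj_on_def)
    then have cB: "card B = r" unfolding r_def by (rule bij_betw_same_card)
    have jB: "j \<in> B" "B \<subseteq> R" using j \<open>\<sigma> j \<in> N j \<inter> C\<close> by (auto simp: B_def)
    have fB: "finite B" using jB(2) assms(1) by (rule finite_subset)
    have val: "card (N j \<inter> (C - {\<sigma> i})) = (if i \<in> B then q else r)" if "i \<in> R" for i
    proof (cases "i \<in> B")
      case True
      then have "N j \<inter> (C - {\<sigma> i}) = (N j \<inter> C) - {\<sigma> i}" "\<sigma> i \<in> N j \<inter> C"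
        using placements_value[OF assms(3) that] by (auto simp: B_def)
      then show ?thesis using True q r_def assms(2) by simp
    next
      case False
      then have "N j \<inter> (C - {\<sigma> i}) = N j \<inter> C" using that by (auto simp: B_def)
      then show ?thesis using False by (simp add: r_def)
    qed
    have "(\<Sum>i\<in>R - {j}. ln_fact_root (card (N j \<inter> (C - {\<sigma> i})))) = (\<Sum>i\<in>R - {j}. if i \<in> B then ln_fact_root q else ln_fact_root r)"
      using val by (intro sum.cong) auto
    also have "\<dots> = (\<Sum>i\<in>(B - {j}). ln_fact_root q) + (\<Sum>i\<in>(R - B). ln_fact_root r)"
    proof -
      have "(R - {j}) \<inter> B = B - {j}" "(R - {j}) \<inter> - B = R - B" using jB by auto
      then show ?thesis using assms(1) by (simp add: sum.If_cases)
    qed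
    also have "\<dots> = real q * ln_fact_root q + (real (card R) - real r) * ln_fact_root r"
      using jB fB cB q card_mono[OF assms(1) jB(2)] by (simp add: card_Diff_subset of_nat_diff)
    also have "\<dots> = real (card R) * ln_fact_root r - ln (real r)"
      using real_mult_lf[of q] real_mult_lf[of r] ln_fact_Suc[of q] q by (simp add: algebra_simps)
    finally show ?thesis by (simp add: r_def)
  qed
  have "(\<Sum>i\<in>R. \<Sum>j\<in>R - {i}. ln_fact_root (card (N j \<inter> (C - {\<sigma> i})))) =
      (\<Sum>j\<in>R. \<Sum>i\<in>R - {j}. ln_fact_root (card (N j \<inter> (C - {\<sigma> i}))))"
    using sum.swap_restrict[OF assms(1) assms(1), of "\<lambda>i j. ln_fact_root (card (N j \<inter> (C - {\<sigma> i})))" "\<lambda>i j. i \<noteq> j"]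
    by (simp add: set_diff_eq) (smt (verit, best) Collect_cong sum.cong)
  then show ?thesis
    by (simp add: sum.distrib row sum_subtractf sum_distrib_left)
qed
text \<open>For each row, P ln P <= \<open>u i\<close> by Jensen, and \<open>u i\<close> is at most
  the sum of \<open>b \<sigma> i\<close> over all placements by the bound for minors. Summing over
  the rows as well gives P |R| times the right-hand side by \<open>placements_degree_sum\<close>.
  The equality case is part of the induction because it is applied to minors.\<close>

lemma bregman:
  assumes "finite R" "finite C" "placements R C N \<noteq> {}"
  shows "ln (real (card (placements R C N))) \<le> (\<Sum>i\<in>R. ln_fact_root (card (N i \<inter> C)))"
    and "ln (real (card (placements R C N))) = (\<Sum>i\<in>R. ln_fact_root (card (N i \<inter> C))) \<Longrightarrow>
      i \<in> R \<Longrightarrow> j \<in> R \<Longrightarrow> N i \<inter> N j \<inter> C \<noteq> {} \<Longrightarrow> N i \<inter> C = N j \<inter> C"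
proof -
  have "ln (real (card (placements R C N))) \<le> (\<Sum>i\<in>R. ln_fact_root (card (N i \<inter> C))) \<and>
    (ln (real (card (placements R C N))) = (\<Sum>i\<in>R. ln_fact_root (card (N i \<inter> C))) \<longrightarrow>
      (\<forall>i\<in>R. \<forall>j\<in>R. N i \<inter> N j \<inter> C \<noteq> {} \<longrightarrow> N i \<inter> C = N j \<inter> C))"
    using assms
  proof (induction "card R" arbitrary: R C)
    case 0
    then have "R = {}" by simp
    with 0 have "placements R C N = {\<lambda>_. undefined}"
      by (auto simp: placements_def bij_betw_def)
    then show ?case using \<open>R = {}\<close> by simp
  next
    case (Suc n)
    note fin = \<open>finite R\<close> \<open>finite C\<close>
    define P where "P = real (card (placements R C N))"
    define F where "F R C = (\<Sum>i\<in>R. ln_fact_root (card (N i \<inter> C)))" for R C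
    define t where "t i k = real (card (placements (R - {i}) (C - {k}) N))" for i k
    define r where "r i = card (N i \<inter> C)" for i
    have finS: "finite (placements R C N)" using fin by (rule finite_placements)
    have P: "0 < P" using Suc.prems finS by (simp add: P_def card_gt_0_iff)
    have tsum: "P = (\<Sum>k\<in>N i \<inter> C. t i k)" if "i \<in> R" for i
      using sum_over_placements[OF fin that, where N = N and h = "\<lambda>_. 1"] by (simp add: P_def t_def)
    have ne: "N i \<inter> C \<noteq> {}" if "i \<in> R" for i
      using placements_value[of _ R C N i] Suc.prems(3) that by blast
    have minor: "placements (R - {i}) (C - {\<sigma> i}) N \<noteq> {}" if "i \<in> R" "\<sigma> \<in> placements R C N" for i \<sigma>
      using bij_betw_placements_minor[of i R "\<sigma> i" N C] placements_value[OF that(2,1)] that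
      by (auto simp: bij_betw_def)
    have IH: "ln (t i (\<sigma> i)) \<le> F (R - {i}) (C - {\<sigma> i}) \<and>
        (ln (t i (\<sigma> i)) = F (R - {i}) (C - {\<sigma> i}) \<longrightarrow>
          (\<forall>j\<in>R - {i}. \<forall>l\<in>R - {i}. N j \<inter> N l \<inter> (C - {\<sigma> i}) \<noteq> {} \<longrightarrow>
             N j \<inter> (C - {\<sigma> i}) = N l \<inter> (C - {\<sigma> i})))"
      if "i \<in> R" "\<sigma> \<in> placements R C N" for i \<sigma>
      unfolding t_def F_def using that Suc.hyps(2) fin minor[OF that]
      by (intro Suc.hyps(1)) auto
    define u where "u i = P * ln (real (r i)) + (\<Sum>k\<in>N i \<inter> C. t i k * ln (t i k))" for i
    have jensen: "P * ln P \<le> u i" if "i \<in> R" for i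
      unfolding u_def r_def using ne[OF that] fin P tsum[OF that]
      by (intro sum_x_ln_x_ge) (auto simp: t_def)
    have u_eq: "u i = (\<Sum>\<sigma>\<in>placements R C N. ln (real (r i)) + ln (t i (\<sigma> i)))" if "i \<in> R" for i
      using sum_over_placements[OF fin that, where N = N and h = "\<lambda>k. ln (t i k)"]
      by (simp add: u_def sum.distrib P_def t_def)
    define b where "b \<sigma> i = ln (real (r i)) + F (R - {i}) (C - {\<sigma> i})" for \<sigma> i
    have bsum: "(\<Sum>\<sigma>\<in>placements R C N. \<Sum>i\<in>R. b \<sigma> i) = P * (real (card R) * F R C)"
      using placements_degree_sum[OF fin, of _ N] by (simp add: b_def F_def r_def P_def)
    have u_le: "u i \<le> (\<Sum>\<sigma>\<in>placements R C N. b \<sigma> i)" if "i \<in> R" for i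
      unfolding u_eq[OF that] b_def using IH[OF that] by (intro sum_mono) auto
    have cR: "0 < real (card R)" using Suc.hyps(2) by simp
    have "(\<Sum>i\<in>R. P * ln P) \<le> (\<Sum>i\<in>R. u i)" using jensen by (rule sum_mono)
    moreover have "(\<Sum>i\<in>R. u i) \<le> (\<Sum>i\<in>R. \<Sum>\<sigma>\<in>placements R C N. b \<sigma> i)" using u_le by (rule sum_mono)
    moreover have bsum': "(\<Sum>i\<in>R. \<Sum>\<sigma>\<in>placements R C N. b \<sigma> i) = P * (real (card R) * F R C)"
      using bsum by (subst sum.swap)
    ultimately have "(P * real (card R)) * ln P \<le> (P * real (card R)) * F R C"
      by (simp add: mult_ac)
    then have le: "ln P \<le> F R C" using P cR by simp
    have struct: "N i \<inter> C = N j \<inter> C"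
      if eq: "ln P = F R C" and ij: "i \<in> R" "j \<in> R" and meet: "N i \<inter> N j \<inter> C \<noteq> {}" for i j
    proof -
      \<comment> \<open>Equal ends of the chain make every link tight: Jensen in each row
        (\<open>tight1\<close>), the passage to the minors (\<open>tight2\<close>), and Bregman for
        each minor reached by a placement (\<open>tight3\<close>).\<close>
      have tot: "(\<Sum>i\<in>R. P * ln P) = (\<Sum>i\<in>R. \<Sum>\<sigma>\<in>placements R C N. b \<sigma> i)"
        using eq bsum' by simp
      have tight1: "P * ln P = u i" if "i \<in> R" for i
      proof (rule ccontr)
        assume "P * ln P \<noteq> u i"
        then have "(\<Sum>i\<in>R. P * ln P) < (\<Sum>i\<in>R. u i)"
          using jensen that fin by (intro sum_strict_mono_ex1) (auto simp: less_le)
        then show False using sum_mono[OF u_le, of R "\<lambda>i. i"] tot by simp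
      qed
      have tight2: "u i = (\<Sum>\<sigma>\<in>placements R C N. b \<sigma> i)" if "i \<in> R" for i
      proof (rule ccontr)
        assume "u i \<noteq> (\<Sum>\<sigma>\<in>placements R C N. b \<sigma> i)"
        then have "(\<Sum>i\<in>R. u i) < (\<Sum>i\<in>R. \<Sum>\<sigma>\<in>placements R C N. b \<sigma> i)"
          using u_le that fin by (intro sum_strict_mono_ex1) (auto simp: less_le)
        then show False using sum_mono[OF jensen, of R "\<lambda>i. i"] tot by simp
      qed
      have tight3: "ln (t i (\<sigma> i)) = F (R - {i}) (C - {\<sigma> i})"
        if "i \<in> R" "\<sigma> \<in> placements R C N" for i \<sigma>
      proof (rule ccontr)
        assume "ln (t i (\<sigma> i)) \<noteq> F (R - {i}) (C - {\<sigma> i})"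
        then have "u i < (\<Sum>\<sigma>\<in>placements R C N. b \<sigma> i)"
          unfolding u_eq[OF that(1)] b_def
          using IH[OF that(1)] that finS by (intro sum_strict_mono_ex1) (auto simp: less_le)
        then show False using tight2[OF that(1)] by simp
      qed
      have rpos: "0 < r i" if "i \<in> R" for i
        using ne[OF that] fin by (simp add: r_def card_gt_0_iff)
      have t_val: "t i k = P / real (r i)" if "i \<in> R" "k \<in> N i \<inter> C" for i k
        unfolding r_def
        using that ne[OF that(1)] fin P tsum[OF that(1)] tight1[OF that(1), unfolded u_def r_def]
        by (intro sum_x_ln_x_ge(2)[of "N i \<inter> C"]) (auto simp: t_def)
      \<comment> \<open>Tight Jensen makes all minors along a row equal and hence positive. So every
        nonzero entry lies on some placement, and \<open>tight3\<close> becomes available at each of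
        them.\<close>
      have through: "\<exists>\<sigma>\<in>placements R C N. \<sigma> i = k" if "i \<in> R" "k \<in> N i \<inter> C" for i k
      proof -
        have "0 < t i k" using t_val[OF that] P rpos[OF that(1)] by simp
        then have "0 < card {\<sigma> \<in> placements R C N. \<sigma> i = k}"
          using card_placements_fiber[of i R k N C] that by (simp add: t_def)
        then show ?thesis by (auto simp: card_gt_0_iff)
      qed
      \<comment> \<open>The right-hand side depends on the column only, so rows meeting in a column have equal size.\<close>
      have gap: "ln_fact_root_gap (r i) = ln P - (\<Sum>j\<in>R. ln_fact_root (card (N j \<inter> (C - {k}))))"
        if ik: "i \<in> R" "k \<in> N i \<inter> C" for i k
      proof -
        obtain \<sigma> where s: "\<sigma> \<in> placements R C N" "\<sigma> i = k" using through[OF ik] by auto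
        have "ln (P / real (r i)) = F (R - {i}) (C - {k})"
          using tight3[OF that(1) s(1)] s(2) t_val[OF that] by simp
        moreover have "ln (P / real (r i)) = ln P - ln (real (r i))"
          using P rpos[OF that(1)] by (simp add: ln_div)
        moreover have "F (R - {i}) (C - {k}) =
            (\<Sum>j\<in>R. ln_fact_root (card (N j \<inter> (C - {k})))) - ln_fact_root (card (N i \<inter> (C - {k})))"
          unfolding F_def using fin that(1) by (simp add: sum_diff1)
        moreover have "card (N i \<inter> (C - {k})) = r i - 1"
        proof -
          have "N i \<inter> (C - {k}) = (N i \<inter> C) - {k}" by auto
          then show ?thesis using that fin by (simp add: r_def)
        qed
        ultimately show ?thesis by (simp add: ln_fact_root_gap_def)
      qed
      obtain c where c: "c \<in> N i \<inter> C" "c \<in> N j \<inter> C" using meet by auto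
      have rij: "r i = r j"
        using gap[OF ij(1) c(1)] gap[OF ij(2) c(2)] rpos ij by (intro ln_fact_root_gap_inj) auto
      show ?thesis
      proof (cases "R \<subseteq> {i, j}")
        \<comment> \<open>No third row can be deleted here. Two distinct rows form a 2 by 2 matrix;
          row j contains c and another column, so by equal size both rows are full.\<close>
        case True
        show ?thesis
        proof (cases "i = j")
          case False
          obtain \<sigma> where s: "\<sigma> \<in> placements R C N" using Suc.prems(3) by auto
          then have "card R = card C" by (auto simp: placements_def dest: bij_betw_same_card)
          moreover have "R = {i, j}" using True ij by blast
          then have "card R = 2" using False by simp
          ultimately have cC: "card C = 2" by simp
          obtain \<tau> where t: "\<tau> \<in> placements R C N" "\<tau> i = c" using through[OF ij(1) c(1)] by auto
          have "\<tau> j \<noteq> c" using t ij False by (auto simp: placements_def bij_betw_def inj_on_def)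
          then have "{c, \<tau> j} \<subseteq> N j \<inter> C" using c placements_value[OF t(1) ij(2)] by auto
          then have "2 \<le> r j" unfolding r_def using fin \<open>\<tau> j \<noteq> c\<close>
            by (metis card_2_iff card_mono finite_Int)
          then have "N i \<inter> C = C" "N j \<inter> C = C"
            using rij cC fin card_seteq[of C "N i \<inter> C"] card_seteq[of C "N j \<inter> C"] by (simp_all add: r_def)
          then show ?thesis by simp
        qed simp
      next
        case False
        \<comment> \<open>Deleting a third row and a column other than c keeps rows i and j meeting, so they agree
          off that column by induction; having equal sizes, they agree there as well.\<close>
        then obtain l where l: "l \<in> R" "l \<noteq> i" "l \<noteq> j" by auto
        obtain \<tau> where t: "\<tau> \<in> placements R C N" "\<tau> i = c" using through[OF ij(1) c(1)] by auto
        define k where "k = \<tau> l"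
        have k: "k \<noteq> c" using t l ij by (auto simp: k_def placements_def bij_betw_def inj_on_def)
        have "N i \<inter> N j \<inter> (C - {k}) \<noteq> {}" using c k by auto
        then have off: "N i \<inter> (C - {k}) = N j \<inter> (C - {k})"
          using IH[OF l(1) t(1)] tight3[OF l(1) t(1)] ij l by (auto simp: k_def)
        have split: "card (N x \<inter> C) = card (N x \<inter> (C - {k})) + (if k \<in> N x \<inter> C then 1 else 0)" for x
        proof (cases "k \<in> N x \<inter> C")
          case True
          then have "N x \<inter> C = insert k (N x \<inter> (C - {k}))" by auto
          then show ?thesis using True fin by simp
        next
          case False
          then have "N x \<inter> C = N x \<inter> (C - {k})" by auto
          then show ?thesis using False by simp
        qed
        have "(if k \<in> N i \<inter> C then 1 else 0 :: nat) = (if k \<in> N j \<inter> C then 1 else 0)"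
          using rij split[of i] split[of j] arg_cong[OF off, of card] unfolding r_def by linarith
        then have "k \<in> N i \<inter> C \<longleftrightarrow> k \<in> N j \<inter> C" by (metis zero_neq_one)
        with off show ?thesis by blast
      qed
    qed
    show ?case using le struct unfolding P_def F_def by blast
  qed
  then show "ln (real (card (placements R C N))) \<le> (\<Sum>i\<in>R. ln_fact_root (card (N i \<inter> C)))"
    "ln (real (card (placements R C N))) = (\<Sum>i\<in>R. ln_fact_root (card (N i \<inter> C))) \<Longrightarrow>
      i \<in> R \<Longrightarrow> j \<in> R \<Longrightarrow> N i \<inter> N j \<inter> C \<noteq> {} \<Longrightarrow> N i \<inter> C = N j \<inter> C" by blast+
qed

section \<open>Pairs of perfect matchings as permutations\<close>

text \<open>The perfect matchings of the complete graph on V, as maps to the partner;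
  \<open>extensional\<close> identifies maps that agree on V.\<close>

definition fpf_involutions :: "'a set \<Rightarrow> ('a \<Rightarrow> 'a) set" where
  "fpf_involutions V = {f \<in> extensional V. \<forall>v\<in>V. f v \<in> V \<and> f v \<noteq> v \<and> f (f v) = v}"

lemma fpf_involutionsD:
  assumes "f \<in> fpf_involutions V" "v \<in> V" shows "f v \<in> V" "f v \<noteq> v" "f (f v) = v"
  using assms by (auto simp: fpf_involutions_def)

definition closed_under :: "('a \<Rightarrow> 'a) \<Rightarrow> ('a \<Rightarrow> 'a) \<Rightarrow> 'a set \<Rightarrow> bool" where
  "closed_under f g W \<longleftrightarrow> (\<forall>x\<in>W. f x \<in> W \<and> g x \<in> W)"

lemma closed_under_Diff:
  assumes "f \<in> fpf_involutions V" "g \<in> fpf_involutions V" "closed_under f g U" "closed_under f g W" "U \<subseteq> V"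
  shows "closed_under f g (U - W)"
  unfolding closed_under_def
proof
  fix x assume x: "x \<in> U - W"
  then have "x \<in> V" using assms(5) by blast
  with x assms show "f x \<in> U - W \<and> g x \<in> U - W"
    unfolding closed_under_def by (metis Diff_iff fpf_involutionsD(3))
qed

lemma alternating_power_in:
  assumes "f \<in> fpf_involutions V" "g \<in> fpf_involutions V" "x \<in> V"
  shows "((g \<circ> f) ^^ k) x \<in> V"
  using assms by (induction k) (auto simp: fpf_involutionsD)

text \<open>This is the evenness of alternating cycles. With h = g o f, cancelling g and f in
  h^(k+2) x = f x leaves h^k (h x) = f (h x), the same equation with exponent k. The descent ends in
  x = f x or g (f x) = f x, both excluded by the absence of fixed points.\<close>

lemma alternating_power_neq:
  assumes "f \<in> fpf_involutions V" "g \<in> fpf_involutions V" "x \<in> V"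
  shows "((g \<circ> f) ^^ k) x \<noteq> f x"
  using assms(3)
proof (induction k arbitrary: x rule: induct_nat_012)
  case 0
  then show ?case using fpf_involutionsD[OF assms(1)] by (metis funpow_0)
next
  case 1
  then show ?case using fpf_involutionsD[OF assms(1)] fpf_involutionsD[OF assms(2)] by simp
next
  case (ge2 k)
  let ?h = "g \<circ> f"
  show ?case
  proof
    assume eq: "(?h ^^ Suc (Suc k)) x = f x"
    have hx: "?h x \<in> V" using ge2.prems assms by (simp add: fpf_involutionsD)
    define z where "z = (?h ^^ k) (?h x)"
    have z: "z \<in> V" using alternating_power_in[OF assms(1,2) hx] by (simp add: z_def)
    have "(?h ^^ Suc (Suc k)) x = ?h ((?h ^^ Suc k) x)" by simp
    also have "(?h ^^ Suc k) x = z" unfolding z_def by (simp only: funpow_Suc_right comp_apply)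
    finally have "?h z = f x" using eq by (simp only:)
    then have "g (f z) = f x" by simp
    then have "f z = g (f x)" using z ge2.prems assms by (metis fpf_involutionsD(1,3))
    then have "z = f (?h x)" using z assms by (metis comp_apply fpf_involutionsD(3))
    with ge2.IH(1)[OF hx] show False unfolding z_def by (rule notE)
  qed
qed

text \<open>The last clause selects one of the two proper 2-colourings of every connected component of the
  union of two perfect matchings, in a way that depends only on the vertex set of the component.\<close>

definition alternating_class :: "('a \<Rightarrow> nat) \<Rightarrow> 'a set \<Rightarrow> ('a \<Rightarrow> 'a) \<Rightarrow> ('a \<Rightarrow> 'a) \<Rightarrow> 'a set \<Rightarrow> bool" where
  "alternating_class e U f g X \<longleftrightarrow> X \<subseteq> U \<and>
     (\<forall>x\<in>U. (f x \<in> X \<longleftrightarrow> x \<notin> X) \<and> (g x \<in> X \<longleftrightarrow> x \<notin> X)) \<and>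
     (\<forall>W\<subseteq>U. \<forall>w\<in>W. closed_under f g W \<and> (\<forall>y\<in>W. e w \<le> e y) \<longrightarrow> w \<in> X)"

lemma exists_alternating_class:
  assumes f: "f \<in> fpf_involutions V" and g: "g \<in> fpf_involutions V" and V: "finite V" "inj_on e V"
    and "U \<subseteq> V" "closed_under f g U"
  shows "\<exists>X. alternating_class e U f g X"
  using assms(5,6)
proof (induction "card U" arbitrary: U rule: less_induct)
  case less
  note fD = fpf_involutionsD[OF f] and gD = fpf_involutionsD[OF g]
  have finU: "finite U" using less.prems V finite_subset by blast
  show ?case
  proof (cases "U = {}")
    case True
    then show ?thesis by (auto simp: alternating_class_def)
  next
    case False
    define u where "u = arg_min_on e U"
    have u: "u \<in> U" "e u \<le> e y" if "y \<in> U" for y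
      using arg_min_if_finite[OF finU False, of e] that by (auto simp: u_def not_less)
    have uU: "u \<in> U" using False u by blast
    then have uV: "u \<in> V" using less.prems by blast
    define h where "h = g \<circ> f"
    define B where "B = range (\<lambda>k. (h ^^ k) u)"
    have BV: "B \<subseteq> V" using alternating_power_in[OF f g uV] by (auto simp: B_def h_def)
    have finB: "finite B" using BV V(1) by (rule finite_subset)
    have uB: "u \<in> B" unfolding B_def by (rule range_eqI[of _ _ 0]) simp
    have "h ` B \<subseteq> B"
      by (auto simp: B_def) (metis comp_apply funpow.simps(2) rangeI)
    moreover have "inj_on h V" unfolding h_def
      by (rule inj_onI) (metis comp_apply fD(1,3) gD(3))
    then have "inj_on h B" using BV inj_on_subset by blast
    \<comment> \<open>Being injective on a finite set, h is onto B: every x in B has the form g (f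
      y) with y in B, and so g x = f y lies in the other class.\<close>
    ultimately have hB: "h ` B = B" using finB endo_inj_surj by blast
    define C where "C = B \<union> f ` B"
    have fB: "f x \<in> f ` B" "g x \<in> f ` B" if "x \<in> B" for x
    proof -
      have "x \<in> h ` B" using that hB by simp
      then obtain y where y: "y \<in> B" "x = g (f y)" by (auto simp: h_def)
      then have "g x = f y" using BV fD(1) gD(3) by blast
      then show "g x \<in> f ` B" using y by blast
    qed (use that in blast)
    have Bf: "f x \<in> B" "g x \<in> B" if x: "x \<in> f ` B" for x
    proof -
      obtain y where y: "y \<in> B" "x = f y" using x by blast
      then show "f x \<in> B" using BV fD(3)[of y] by auto
      have "h y \<in> B" using y hB by blast
      then show "g x \<in> B" using y by (simp add: h_def)
    qed
    have disj: "B \<inter> f ` B = {}"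
    proof (rule ccontr)
      assume "B \<inter> f ` B \<noteq> {}"
      then obtain i j where ij: "(h ^^ i) u = f ((h ^^ j) u)" by (auto simp: B_def)
      have inV: "(h ^^ k) u \<in> V" for k using BV by (auto simp: B_def)
      show False
      proof (cases "j \<le> i")
        case True
        then have "(h ^^ (i - j)) ((h ^^ j) u) = f ((h ^^ j) u)"
          using ij by (metis comp_apply funpow_add le_add_diff_inverse2)
        then show False using alternating_power_neq[OF f g inV, folded h_def] by blast
      next
        case False
        then have "(h ^^ (j - i)) ((h ^^ i) u) = (h ^^ j) u"
          by (metis comp_apply funpow_add le_add_diff_inverse2 nat_le_linear)
        also have "\<dots> = f ((h ^^ i) u)" using ij fD(3)[OF inV[of j]] by simp
        finally show False using alternating_power_neq[OF f g inV, folded h_def] by blast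
      qed
    qed
    have closedC: "closed_under f g C"
      using fB Bf by (auto simp: C_def closed_under_def)
    have minimal: "C \<subseteq> W" if "closed_under f g W" "u \<in> W" for W
    proof -
      have "(h ^^ k) u \<in> W" for k
        using that by (induction k) (auto simp: h_def closed_under_def)
      then show ?thesis using that by (auto simp: C_def B_def closed_under_def)
    qed
    have CU: "C \<subseteq> U" using minimal less.prems uU by blast
    have "closed_under f g (U - C)" using closed_under_Diff[OF f g] less.prems closedC by blast
    moreover have "card (U - C) < card U"
      using uU uB finU by (intro psubset_card_mono) (auto simp: C_def)
    ultimately obtain X where X: "alternating_class e (U - C) f g X"
      using less.hyps[of "U - C"] less.prems(1) by blast
    have XU: "X \<subseteq> U - C" using X by (simp add: alternating_class_def)
    have "alternating_class e U f g (X \<union> B)"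
      unfolding alternating_class_def
    proof (intro conjI ballI allI impI)
      show "X \<union> B \<subseteq> U" using XU CU by (auto simp: C_def)
    next
      fix x assume "x \<in> U"
      consider "x \<in> U - C" | "x \<in> B" | "x \<in> f ` B" using \<open>x \<in> U\<close> by (auto simp: C_def)
      then have "(f x \<in> X \<union> B \<longleftrightarrow> x \<notin> X \<union> B) \<and> (g x \<in> X \<union> B \<longleftrightarrow> x \<notin> X \<union> B)"
      proof cases
        case 1
        then have "f x \<in> U - C" "g x \<in> U - C"
          using \<open>closed_under f g (U - C)\<close> by (auto simp: closed_under_def)
        with 1 X show ?thesis by (auto simp: alternating_class_def C_def)
      next
        case 2
        with fB[OF 2] disj XU show ?thesis unfolding C_def by blast
      next
        case 3
        with Bf[OF 3] disj XU show ?thesis unfolding C_def by blast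
      qed
      then show "(f x \<in> X \<union> B) = (x \<notin> X \<union> B)" "(g x \<in> X \<union> B) = (x \<notin> X \<union> B)" by blast+
    next
      fix W w
      assume W: "W \<subseteq> U" "w \<in> W" "closed_under f g W \<and> (\<forall>y\<in>W. e w \<le> e y)"
      show "w \<in> X \<union> B"
      proof (cases "u \<in> W")
        case True
        then have "e w = e u" using W u(2)[of w] by (auto intro: order_antisym)
        then have "w = u" using W(1,2) uV less.prems(1) V(2) by (auto dest: inj_onD)
        then show ?thesis using uB by simp
      next
        \<comment> \<open>A closed set W that misses u misses its whole component, because U - W is
          closed and contains u.\<close>
        case False
        then have "u \<in> U - W" using uU by simp
        moreover have "closed_under f g (U - W)" using closed_under_Diff[OF f g] less.prems W by blast
        ultimately have "W \<subseteq> U - C" using minimal[of "U - W"] W(1) by blast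
        then show ?thesis using X W by (auto simp: alternating_class_def)
      qed
    qed
    then show ?thesis by blast
  qed
qed

section \<open>Gluing two matchings into one permutation\<close>

definition glue :: "'a set \<Rightarrow> 'a set \<Rightarrow> ('a \<Rightarrow> 'a) \<Rightarrow> ('a \<Rightarrow> 'a) \<Rightarrow> 'a \<Rightarrow> 'a" where
  "glue V X f g = (\<lambda>x\<in>V. if x \<in> X then f x else g x)"

text \<open>Every vertex crosses to the other colour class, so values from X and from outside X
  never collide, and on each side f or g is injective. Common edges become transpositions; longer
  cycles are run through in one direction.\<close>

lemma glue_placement:
  assumes f: "f \<in> fpf_involutions V" and g: "g \<in> fpf_involutions V" and V: "finite V"
    and X: "alternating_class e V f g X" and N: "\<And>v. v \<in> V \<Longrightarrow> f v \<in> N v \<and> g v \<in> N v"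
  shows "glue V X f g \<in> placements V V N"
proof -
  note fD = fpf_involutionsD[OF f] and gD = fpf_involutionsD[OF g]
  have side: "glue V X f g x \<in> X \<longleftrightarrow> x \<notin> X" if "x \<in> V" for x
    using that X by (auto simp: glue_def alternating_class_def)
  have "inj_on (glue V X f g) V"
  proof (rule inj_onI)
    fix x y assume xy: "x \<in> V" "y \<in> V" "glue V X f g x = glue V X f g y"
    then have "x \<in> X \<longleftrightarrow> y \<in> X" using side by metis
    then show "x = y" using xy fD(3) gD(3) by (auto simp: glue_def split: if_splits) metis+
  qed
  moreover have "glue V X f g ` V \<subseteq> V" using fD gD by (auto simp: glue_def)
  ultimately have "bij_betw (glue V X f g) V V"
    using V by (simp add: bij_betw_def endo_inj_surj)
  then show ?thesis using N by (auto simp: placements_def glue_def)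
qed

text \<open>The permutation p and its inverse yield both partners of a vertex, and the colour class
  tells which is which. Where X and X' agree the two pairs coincide; where they differ the pairs are
  exchanged. The set W of differing vertices is thus closed under both pairs, and its least vertex
  would have to lie in both classes.\<close>

lemma glue_inj:
  assumes V: "finite V" "inj_on e V"
    and f: "f \<in> fpf_involutions V" and g: "g \<in> fpf_involutions V" and X: "alternating_class e V f g X"
    and f': "f' \<in> fpf_involutions V" and g': "g' \<in> fpf_involutions V" and X': "alternating_class e V f' g' X'"
    and eq: "glue V X f g = glue V X' f' g'"
  shows "f = f' \<and> g = g'"
proof -
  define p where "p = glue V X f g"
  have inj: "inj_on p V"
    using glue_placement[OF f g V(1) X, of "\<lambda>_. UNIV"] by (auto simp: placements_def bij_betw_def p_def)
  \<comment> \<open>On X the permutation leaves along f and arrives along g, since g x is then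
    outside X; off X the roles are exchanged.\<close>
  have vals:
    "(x \<in> X \<longrightarrow> f x = p x \<and> p (g x) = x) \<and> (x \<notin> X \<longrightarrow> g x = p x \<and> p (f x) = x)"
    if "x \<in> V" "f \<in> fpf_involutions V" "g \<in> fpf_involutions V" "alternating_class e V f g X"
       "p = glue V X f g" for f g X x
    using that fpf_involutionsD[OF that(2,1)] fpf_involutionsD[OF that(3,1)]
    by (auto simp: glue_def alternating_class_def)
  note 1 = vals[OF _ f g X p_def] and 2 = vals[OF _ f' g' X' p_def[unfolded eq]]
  note fD = fpf_involutionsD[OF f] and gD = fpf_involutionsD[OF g]
  note fD' = fpf_involutionsD[OF f'] and gD' = fpf_involutionsD[OF g']
  have pinj: "y = z" if "p y = x" "p z = x" "y \<in> V" "z \<in> V" for x y z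
    using that inj by (auto dest: inj_onD)
  have same: "f x = f' x \<and> g x = g' x" if x: "x \<in> V" "x \<in> X \<longleftrightarrow> x \<in> X'" for x
  proof (cases "x \<in> X")
    case True
    then show ?thesis using 1[OF x(1)] 2[OF x(1)] x pinj[OF _ _ gD(1)[OF x(1)] gD'(1)[OF x(1)]] by simp
  next
    case False
    then show ?thesis using 1[OF x(1)] 2[OF x(1)] x pinj[OF _ _ fD(1)[OF x(1)] fD'(1)[OF x(1)]] by simp
  qed
  have cross: "f x = g' x \<and> g x = f' x" if x: "x \<in> V" "x \<in> X \<longleftrightarrow> x \<notin> X'" for x
  proof (cases "x \<in> X")
    case True
    then show ?thesis using 1[OF x(1)] 2[OF x(1)] x pinj[OF _ _ gD(1)[OF x(1)] fD'(1)[OF x(1)]] by simp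
  next
    case False
    then show ?thesis using 1[OF x(1)] 2[OF x(1)] x pinj[OF _ _ fD(1)[OF x(1)] gD'(1)[OF x(1)]] by simp
  qed
  define W where "W = {x \<in> V. x \<in> X \<longleftrightarrow> x \<notin> X'}"
  have swap: "(f x \<in> X \<longleftrightarrow> x \<notin> X) \<and> (g x \<in> X \<longleftrightarrow> x \<notin> X) \<and> (f' x \<in> X' \<longleftrightarrow> x \<notin> X') \<and> (g' x \<in> X' \<longleftrightarrow> x \<notin> X')"
    if "x \<in> V" for x
    using that X X' by (simp add: alternating_class_def)
  have W: "closed_under f g W" "closed_under f' g' W"
    unfolding closed_under_def
  proof (safe)
    fix x assume "x \<in> W"
    then have x: "x \<in> V" "x \<in> X \<longleftrightarrow> x \<notin> X'" by (auto simp: W_def)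
    note facts = swap[OF x(1)] cross[OF x] x fD(1)[OF x(1)] gD(1)[OF x(1)]
    show "f x \<in> W" "g x \<in> W" "f' x \<in> W" "g' x \<in> W"
      using facts by (simp_all add: W_def)
  qed
  have "W = {}"
  proof (rule ccontr)
    assume ne: "W \<noteq> {}"
    have fin: "finite W" using V by (simp add: W_def)
    define w where "w = arg_min_on e W"
    have w: "w \<in> W" "\<forall>y\<in>W. e w \<le> e y"
      using arg_min_if_finite[OF fin ne, of e] by (auto simp: w_def not_less)
    have "W \<subseteq> V" by (auto simp: W_def)
    then have "w \<in> X" "w \<in> X'" using X X' W w by (auto simp: alternating_class_def)
    then show False using w by (simp add: W_def)
  qed
  then have "\<And>x. x \<in> V \<Longrightarrow> f x = f' x \<and> g x = g' x" using same by (auto simp: W_def)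
  then show ?thesis
    using f f' g g' by (auto simp: fpf_involutions_def intro: extensionalityI)
qed

lemma card_fpf_involutions_sq_le:
  fixes N :: "'a \<Rightarrow> 'a set"
  assumes V: "finite V"
  defines "I \<equiv> {f \<in> fpf_involutions V. \<forall>v\<in>V. f v \<in> N v}"
  shows "(card I)\<^sup>2 \<le> card (placements V V N)"
proof -
  obtain e :: "'a \<Rightarrow> nat" where e: "inj_on e V"
    using finite_imp_inj_to_nat_seg[OF V] by metis
  have "\<exists>X. alternating_class e V f g X" if "f \<in> I" "g \<in> I" for f g
  proof (rule exists_alternating_class[OF _ _ V e])
    show f: "f \<in> fpf_involutions V" and g: "g \<in> fpf_involutions V" using that by (simp_all add: I_def)
    show "closed_under f g V"
      using fpf_involutionsD(1)[OF f] fpf_involutionsD(1)[OF g] by (simp add: closed_under_def)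
  qed simp
  \<comment> \<open>Any choice of a class for each pair will do: \<open>glue_inj\<close> compares
    arbitrary admissible classes.\<close>
  then obtain X where X: "\<And>f g. f \<in> I \<Longrightarrow> g \<in> I \<Longrightarrow> alternating_class e V f g (X f g)"
    by metis
  have IF: "f \<in> fpf_involutions V" "v \<in> V \<Longrightarrow> f v \<in> N v" if "f \<in> I" for f v
    using that by (auto simp: I_def)
  have "inj_on (\<lambda>(f, g). glue V (X f g) f g) (I \<times> I)"
  proof (rule inj_onI)
    fix q q' assume a: "q \<in> I \<times> I" "q' \<in> I \<times> I"
      "(case q of (f, g) \<Rightarrow> glue V (X f g) f g) = (case q' of (f, g) \<Rightarrow> glue V (X f g) f g)"
    obtain f g f' g' where q: "q = (f, g)" "q' = (f', g')" by fastforce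
    have m: "f \<in> I" "g \<in> I" "f' \<in> I" "g' \<in> I" using a q by simp_all
    have "glue V (X f g) f g = glue V (X f' g') f' g'" using a(3) q by simp
    from glue_inj[OF V e IF(1)[OF m(1)] IF(1)[OF m(2)] X[OF m(1,2)]
        IF(1)[OF m(3)] IF(1)[OF m(4)] X[OF m(3,4)] this]
    show "q = q'" using q by simp
  qed
  moreover have "(\<lambda>(f, g). glue V (X f g) f g) ` (I \<times> I) \<subseteq> placements V V N"
  proof (rule image_subsetI)
    fix q assume "q \<in> I \<times> I"
    then obtain f g where q: "q = (f, g)" "f \<in> I" "g \<in> I" by blast
    have "glue V (X f g) f g \<in> placements V V N"
      using IF q by (intro glue_placement[OF _ _ V X]) blast+
    then show "(case q of (f, g) \<Rightarrow> glue V (X f g) f g) \<in> placements V V N" by (simp add: q)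
  qed
  ultimately have "card (I \<times> I) \<le> card (placements V V N)"
    using finite_placements[OF V V] by (intro card_inj_on_le)
  then show ?thesis by (simp add: card_cartesian_product power2_eq_square)
qed

section \<open>Degrees, neighbourhoods and the bound for perfect matchings\<close>

definition fin_graph :: "'a sgraph \<Rightarrow> bool" where
  "fin_graph G \<longleftrightarrow> finite (verts G) \<and> edges G \<subseteq> nsets (verts G) 2"

definition nbrs :: "'a sgraph \<Rightarrow> 'a \<Rightarrow> 'a set" where
  "nbrs G v = {u. {v, u} \<in> edges G}"

lemma simple_graphs_iff:
  "G \<in> simple_graphs N m \<longleftrightarrow> fin_graph G \<and> card (verts G) = N \<and> card (edges G) = m"
  by (auto simp: simple_graphs_def fin_graph_def)

lemma edgeE:
  assumes "fin_graph G" "e \<in> edges G"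
  obtains u v where "e = {u, v}" "u \<noteq> v" "u \<in> verts G" "v \<in> verts G"
  using assms by (auto simp: fin_graph_def nsets_def card_2_iff subset_iff)

lemma finite_edges: "fin_graph G \<Longrightarrow> finite (edges G)"
  by (rule finite_subset[of _ "Pow (verts G)"]) (auto simp: fin_graph_def nsets_def)

lemma nbrs_edge:
  assumes "fin_graph G" "{v, u} \<in> edges G" shows "v \<noteq> u" "v \<in> verts G" "u \<in> verts G"
  using edgeE[OF assms] by (auto simp: doubleton_eq_iff)

lemma nbrs_subset: "fin_graph G \<Longrightarrow> nbrs G v \<subseteq> verts G"
  using nbrs_edge(3)[of G v] by (auto simp: nbrs_def)

lemma nbrs_irrefl: "fin_graph G \<Longrightarrow> v \<notin> nbrs G v"
  using nbrs_edge(1)[of G v v] by (auto simp: nbrs_def)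

lemma nbrs_sym: "u \<in> nbrs G v \<longleftrightarrow> v \<in> nbrs G u"
  by (simp add: nbrs_def insert_commute)

lemma degree_eq_card_nbrs:
  assumes "fin_graph G" shows "degree G v = card (nbrs G v)"
proof -
  have "bij_betw (\<lambda>u. {v, u}) (nbrs G v) {e \<in> edges G. v \<in> e}"
    unfolding bij_betw_def
  proof
    show "inj_on (\<lambda>u. {v, u}) (nbrs G v)" by (auto simp: inj_on_def doubleton_eq_iff)
    show "(\<lambda>u. {v, u}) ` nbrs G v = {e \<in> edges G. v \<in> e}"
    proof safe
      fix e assume e: "e \<in> edges G" "v \<in> e"
      obtain x y where "e = {x, y}" using edgeE[OF assms e(1)] by metis
      then have "\<exists>u. e = {v, u}" using e(2) by auto
      then show "e \<in> (\<lambda>u. {v, u}) ` nbrs G v" using e by (auto simp: nbrs_def)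
    qed (simp_all add: nbrs_def)
  qed
  then show ?thesis by (simp add: degree_def bij_betw_same_card)
qed

lemma handshake:
  assumes "fin_graph G" shows "(\<Sum>v\<in>verts G. degree G v) = 2 * card (edges G)"
proof -
  have "(\<Sum>v\<in>verts G. card {e \<in> edges G. v \<in> e}) = 2 * card (edges G)"
  proof (rule sum_multicount)
    show "finite (verts G)" "finite (edges G)" using assms finite_edges[OF assms] by (simp_all add: fin_graph_def)
    show "\<forall>e\<in>edges G. card {v \<in> verts G. v \<in> e} = 2"
    proof
      fix e assume "e \<in> edges G"
      then obtain u v where "e = {u, v}" "u \<noteq> v" "u \<in> verts G" "v \<in> verts G"
        using edgeE[OF assms] by metis
      moreover from this have "{v \<in> verts G. v \<in> e} = e" by auto
      ultimately show "card {v \<in> verts G. v \<in> e} = 2" by simp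
    qed
  qed
  then show ?thesis by (simp add: degree_def)
qed

section \<open>From perfect matchings to involutions and the degree bound\<close>

definition mate :: "'a sgraph \<Rightarrow> 'a set set \<Rightarrow> 'a \<Rightarrow> 'a" where
  "mate G M = (\<lambda>v\<in>verts G. THE u. {v, u} \<in> M)"

lemma mate_iff:
  assumes "fin_graph G" "perfect_matching G M" "v \<in> verts G"
  shows "{v, u} \<in> M \<longleftrightarrow> u = mate G M v"
proof -
  have "\<exists>!e. e \<in> M \<and> v \<in> e" using assms by (simp add: perfect_matching_def)
  then obtain e where e: "e \<in> M" "v \<in> e" and uniq: "\<And>e'. e' \<in> M \<Longrightarrow> v \<in> e' \<Longrightarrow> e' = e"
    by blast
  have "e \<in> edges G" using e assms by (auto simp: perfect_matching_def)
  from edgeE[OF assms(1) this] obtain w where w: "e = {v, w}" using e(2)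
    by (metis insertE insert_commute singletonD)
  have *: "{v, u} \<in> M \<longleftrightarrow> u = w" for u
    using uniq[of "{v, u}"] e w by (auto simp: doubleton_eq_iff)
  then show ?thesis using assms(3) by (simp add: mate_def)
qed

lemma mate_fpf_involution:
  assumes "fin_graph G" "perfect_matching G M"
  shows "mate G M \<in> fpf_involutions (verts G)" "v \<in> verts G \<Longrightarrow> mate G M v \<in> nbrs G v"
proof -
  have e: "{v, mate G M v} \<in> M" "{v, mate G M v} \<in> edges G" if "v \<in> verts G" for v
    using mate_iff[OF assms that] assms(2) by (auto simp: perfect_matching_def)
  have v: "mate G M v \<in> verts G" "mate G M v \<noteq> v" if "v \<in> verts G" for v
    using nbrs_edge[OF assms(1) e(2)[OF that]] by auto
  have "mate G M (mate G M v) = v" if "v \<in> verts G" for v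
    using mate_iff[OF assms v(1)[OF that], of v] e(1)[OF that] by (simp add: insert_commute)
  then show "mate G M \<in> fpf_involutions (verts G)"
    using v by (simp add: fpf_involutions_def mate_def)
  show "v \<in> verts G \<Longrightarrow> mate G M v \<in> nbrs G v" using e by (simp add: nbrs_def)
qed

lemma inj_on_mate:
  assumes "fin_graph G" shows "inj_on (mate G) {M. perfect_matching G M}"
proof (rule inj_onI)
  have sub: "M \<subseteq> M'" if M: "perfect_matching G M" "perfect_matching G M'" "mate G M = mate G M'" for M M'
  proof
    fix e assume e: "e \<in> M"
    then have "e \<in> edges G" using M by (auto simp: perfect_matching_def)
    then obtain u v where "e = {u, v}" "u \<in> verts G" using edgeE[OF assms] by metis
    then show "e \<in> M'" using mate_iff[OF assms M(1), of u v] mate_iff[OF assms M(2), of u v] M(3) e by simp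
  qed
  fix M M' assume "M \<in> {M. perfect_matching G M}" "M' \<in> {M. perfect_matching G M}" "mate G M = mate G M'"
  then show "M = M'" using sub[of M M'] sub[of M' M] by (simp add: subset_antisym)
qed

lemma perfmat_sq_le:
  assumes "fin_graph G"
  shows "(perfmat G)\<^sup>2 \<le> card (placements (verts G) (verts G) (nbrs G))"
proof -
  have fin: "finite (verts G)" using assms by (simp add: fin_graph_def)
  define I where "I = {f \<in> fpf_involutions (verts G). \<forall>v\<in>verts G. f v \<in> nbrs G v}"
  have "finite I"
    by (rule finite_subset[OF _ finite_PiE[of "verts G" "\<lambda>_. verts G"]])
      (use fin in \<open>auto simp: I_def fpf_involutions_def PiE_def\<close>)
  moreover have "mate G ` {M. perfect_matching G M} \<subseteq> I"
    using mate_fpf_involution[OF assms] by (auto simp: I_def)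
  ultimately have "perfmat G \<le> card I"
    unfolding perfmat_def using inj_on_mate[OF assms] by (intro card_inj_on_le)
  then have "(perfmat G)\<^sup>2 \<le> (card I)\<^sup>2" by (simp add: power_mono)
  also have "\<dots> \<le> card (placements (verts G) (verts G) (nbrs G))"
    unfolding I_def by (rule card_fpf_involutions_sq_le[OF fin])
  finally show ?thesis .
qed

text \<open>At d = 0 the sides differ: the factor is 0 by convention, but
  \<open>exp (ln_fact_root 0 / 2)\<close> is 1. Positivity of all degrees has to be secured before
  each use.\<close>

lemma degree_factor_eq_exp: "0 < d \<Longrightarrow> degree_factor d = exp (ln_fact_root d / 2)"
  by (simp add: degree_factor_def ln_fact_root_def powr_def)

lemma degree_factor_nonneg: "0 \<le> degree_factor d"
  by (simp add: degree_factor_def)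

lemma prod_degree_factor:
  assumes "finite V" "\<And>v. v \<in> V \<Longrightarrow> 0 < d v"
  shows "(\<Prod>v\<in>V. degree_factor (d v)) = exp ((\<Sum>v\<in>V. ln_fact_root (d v)) / 2)"
  using assms by (simp add: degree_factor_eq_exp exp_sum sum_divide_distrib)

text \<open>The form that the equality case of Bregman takes for an adjacency matrix. In a finite
  simple graph it makes each component with an edge complete bipartite, though not yet
  balanced.\<close>

definition blocks :: "'a sgraph \<Rightarrow> bool" where
  "blocks G \<longleftrightarrow> (\<forall>u\<in>verts G. \<forall>v\<in>verts G. nbrs G u \<inter> nbrs G v \<noteq> {} \<longrightarrow> nbrs G u = nbrs G v)"

lemma perfmat_pos_imp_placement:
  assumes "fin_graph G" "0 < perfmat G"
  shows "placements (verts G) (verts G) (nbrs G) \<noteq> {}"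
  using perfmat_sq_le[OF assms(1)] assms(2) by (metis card.empty le_zero_eq not_gr_zero zero_less_power)

text \<open>Bregman's bound is halved because it bounds the square of the number of matchings. A
  positive \<open>perfmat G\<close> supplies a placement, hence positive degrees; it also excludes
  equality of the form 0 = 0, caused by an isolated vertex, which says nothing about the
  structure.\<close>

lemma kahn_lovasz:
  assumes "fin_graph G"
  shows "real (perfmat G) \<le> (\<Prod>v\<in>verts G. degree_factor (degree G v))"
    and "0 < perfmat G \<Longrightarrow> real (perfmat G) = (\<Prod>v\<in>verts G. degree_factor (degree G v)) \<Longrightarrow> blocks G"
proof -
  have fin: "finite (verts G)" using assms by (simp add: fin_graph_def)
  have "real (perfmat G) \<le> (\<Prod>v\<in>verts G. degree_factor (degree G v)) \<and>
    (real (perfmat G) = (\<Prod>v\<in>verts G. degree_factor (degree G v)) \<longrightarrow> blocks G)"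
    if pos: "0 < perfmat G"
  proof -
    define p where "p = real (perfmat G)"
    define Q where "Q = card (placements (verts G) (verts G) (nbrs G))"
    define S where "S = (\<Sum>v\<in>verts G. ln_fact_root (degree G v))"
    have ne: "placements (verts G) (verts G) (nbrs G) \<noteq> {}"
      using perfmat_pos_imp_placement[OF assms pos] .
    have deg: "card (nbrs G v \<inter> verts G) = degree G v" for v
      using nbrs_subset[OF assms, of v] by (simp add: degree_eq_card_nbrs[OF assms] Int_absorb2)
    obtain \<sigma> where s: "\<sigma> \<in> placements (verts G) (verts G) (nbrs G)" using ne by blast
    have dpos: "0 < degree G v" if "v \<in> verts G" for v
      unfolding deg[symmetric] using placements_value[OF s that] fin by (auto simp: card_gt_0_iff)
    have p: "0 < p" using pos by (simp add: p_def)
    have "p\<^sup>2 \<le> real Q" using perfmat_sq_le[OF assms] unfolding p_def Q_def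
      by (metis of_nat_le_iff of_nat_power)
    then have "ln (p\<^sup>2) \<le> ln (real Q)" using p by (intro ln_mono) simp_all
    then have l1: "2 * ln p \<le> ln (real Q)" using p by (simp add: ln_realpow)
    have l2: "ln (real Q) \<le> S" using bregman(1)[OF fin fin ne] by (simp add: Q_def S_def deg)
    have prod: "(\<Prod>v\<in>verts G. degree_factor (degree G v)) = exp (S / 2)"
      unfolding S_def using fin dpos by (rule prod_degree_factor)
    have "ln p \<le> S / 2" using l1 l2 by simp
    then have le: "p \<le> exp (S / 2)" using p by (metis exp_le_cancel_iff exp_ln)
    have "blocks G" if eq: "p = exp (S / 2)"
    proof -
      have "ln p = S / 2" using eq by simp
      then have "ln (real Q) = S" using l1 l2 by simp
      then have "ln (real Q) = (\<Sum>v\<in>verts G. ln_fact_root (card (nbrs G v \<inter> verts G)))" by (simp add: S_def deg)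
      from bregman(2)[OF fin fin ne this[unfolded Q_def]]
      have *: "nbrs G u \<inter> verts G = nbrs G v \<inter> verts G"
        if "u \<in> verts G" "v \<in> verts G" "nbrs G u \<inter> nbrs G v \<inter> verts G \<noteq> {}" for u v
        using that by blast
      have "nbrs G v \<inter> verts G = nbrs G v" for v using nbrs_subset[OF assms, of v] by blast
      moreover have "nbrs G u \<inter> nbrs G v \<inter> verts G = nbrs G u \<inter> nbrs G v" for u v
        using nbrs_subset[OF assms, of v] by blast
      ultimately show ?thesis unfolding blocks_def using * by (simp only: ) blast
    qed
    with le prod show ?thesis by (simp add: p_def)
  qed
  moreover have "0 \<le> (\<Prod>v\<in>verts G. degree_factor (degree G v))"
    by (intro prod_nonneg) (simp add: degree_factor_nonneg)
  ultimately show "real (perfmat G) \<le> (\<Prod>v\<in>verts G. degree_factor (degree G v))"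
    "0 < perfmat G \<Longrightarrow> real (perfmat G) = (\<Prod>v\<in>verts G. degree_factor (degree G v)) \<Longrightarrow> blocks G"
    by (cases "perfmat G = 0"; simp)+
qed

section \<open>The degree product compared with \<open>omega\<close>\<close>

lemma omega_eq_exp:
  assumes "0 < n" "n \<le> m"
  defines "a \<equiv> m div n"
  shows "omega n m = exp (real n * ln_fact_root a + (real m - real n * real a) * (ln_fact_root (Suc a) - ln_fact_root a))"
proof -
  have a: "0 < a" using assms by (simp add: a_def div_greater_zero_iff)
  define b where "b = nat \<lceil>real m / real n\<rceil>"
  define \<alpha> where "\<alpha> = real m - real n * real a"
  have fl: "nat \<lfloor>real m / real n\<rfloor> = a" by (simp add: a_def floor_divide_of_nat_eq)
  have split: "real m = real n * real a + real (m mod n)"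
    unfolding a_def by (metis mult_div_mod_eq of_nat_add of_nat_mult)
  have \<alpha>: "\<alpha> = real (m mod n)" using split by (simp add: \<alpha>_def)
  \<comment> \<open>If n divides m, the ceiling is a and not \<open>Suc a\<close>; then \<alpha> = 0
    and the term with b disappears.\<close>
  have b: "b = Suc a" if "\<alpha> \<noteq> 0"
  proof -
    have "0 < m mod n" "m mod n < n" using that assms by (simp_all add: \<alpha>)
    then have "\<lceil>real m / real n\<rceil> = int (Suc a)"
      unfolding split by (intro ceiling_unique) (auto simp: field_simps assms)
    then show ?thesis by (simp add: b_def)
  qed
  have pw: "(fact k :: real) powr (x / real k) = exp (x * ln_fact_root k)" for k x
    by (simp add: powr_def ln_fact_root_def)
  have "omega n m = exp ((real n - \<alpha>) * ln_fact_root a + \<alpha> * ln_fact_root b)"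
    by (simp add: omega_def Let_def fl pw exp_add flip: \<alpha>_def b_def)
  also have "(real n - \<alpha>) * ln_fact_root a + \<alpha> * ln_fact_root b = real n * ln_fact_root a + \<alpha> * (ln_fact_root (Suc a) - ln_fact_root a)"
    using b by (cases "\<alpha> = 0") (auto simp: algebra_simps)
  finally show ?thesis by (simp add: \<alpha>_def)
qed

text \<open>The average degree is m / n. If all degrees lie between the minimum k and k + 1, and k
  is attained, the average lies in [k, k + 1), which means k = m div n.\<close>

lemma almost_regular_iff:
  assumes "fin_graph G" "0 < n" "card (verts G) = 2 * n" "card (edges G) = m"
  shows "almost_regular G \<longleftrightarrow> (\<forall>v\<in>verts G. degree G v = m div n \<or> degree G v = Suc (m div n))"
proof
  assume ar: "almost_regular G"
  have fin: "finite (verts G)" using assms by (simp add: fin_graph_def)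
  have ne: "verts G \<noteq> {}" using assms by auto
  define k where "k = Min (degree G ` verts G)"
  have "k \<in> degree G ` verts G" using fin ne by (simp add: k_def)
  then obtain w where w: "w \<in> verts G" "degree G w = k" by auto
  have deg: "k \<le> degree G v" "degree G v \<le> Suc k" if "v \<in> verts G" for v
  proof -
    show "k \<le> degree G v" using fin that by (simp add: k_def)
    have "\<bar>int (degree G v) - int (degree G w)\<bar> \<le> 1"
      using ar that w(1) unfolding almost_regular_def by blast
    then show "degree G v \<le> Suc k" using w by simp
  qed
  have sum: "(\<Sum>v\<in>verts G. degree G v) = 2 * m" using handshake[OF assms(1)] assms by simp
  have "(\<Sum>v\<in>verts G. k) \<le> (\<Sum>v\<in>verts G. degree G v)" using deg by (intro sum_mono) auto
  then have "n * k \<le> m" using sum assms by simp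
  moreover have "(\<Sum>v\<in>verts G. degree G v) < (\<Sum>v\<in>verts G. Suc k)"
    using deg w fin by (intro sum_strict_mono_ex1) auto
  then have "m < n * Suc k" using sum assms by simp
  ultimately have "m div n = k" by (intro div_nat_eqI) (simp_all add: mult.commute)
  then show "\<forall>v\<in>verts G. degree G v = m div n \<or> degree G v = Suc (m div n)"
    using deg by (auto simp: le_Suc_eq dest: deg intro: le_antisym)
next
  assume d: "\<forall>v\<in>verts G. degree G v = m div n \<or> degree G v = Suc (m div n)"
  show "almost_regular G" unfolding almost_regular_def
  proof (intro ballI)
    fix u v assume "u \<in> verts G" "v \<in> verts G"
    then have "degree G u = m div n \<or> degree G u = Suc (m div n)"
      "degree G v = m div n \<or> degree G v = Suc (m div n)" using d by blast+
    then show "\<bar>int (degree G u) - int (degree G v)\<bar> \<le> 1" by auto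
  qed
qed

text \<open>The secant T at a = m div n is linear in the degree, so by the handshake lemma its sum
  over the vertices depends on n and m only; it is 2 ln \<open>omega\<close>. Isolated vertices need
  their own case: the product is 0, and n <= m gives almost regular graphs positive degrees.\<close>

lemma degree_product_le_omega:
  assumes G: "fin_graph G" "card (verts G) = 2 * n" "card (edges G) = m" and nm: "0 < n" "n \<le> m"
  shows "(\<Prod>v\<in>verts G. degree_factor (degree G v)) \<le> omega n m"
    and "(\<Prod>v\<in>verts G. degree_factor (degree G v)) = omega n m \<longleftrightarrow> almost_regular G"
proof -
  define a where "a = m div n"
  have a: "0 < a" using nm by (simp add: a_def div_greater_zero_iff)
  have fin: "finite (verts G)" using G by (simp add: fin_graph_def)
  define T where "T d = ln_fact_root a + (real d - real a) * (ln_fact_root (Suc a) - ln_fact_root a)" for d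
  define E where "E = real n * ln_fact_root a + (real m - real n * real a) * (ln_fact_root (Suc a) - ln_fact_root a)"
  have om: "omega n m = exp E" using omega_eq_exp[OF nm] by (simp add: E_def a_def)
  have "(\<Sum>v\<in>verts G. real (degree G v)) = 2 * real m"
    using handshake[OF G(1)] G(3) by (metis of_nat_mult of_nat_numeral of_nat_sum)
  then have T: "(\<Sum>v\<in>verts G. T (degree G v)) = 2 * E"
    by (simp add: T_def E_def sum.distrib sum_subtractf G(2) algebra_simps flip: sum_distrib_right sum_distrib_left)
  have "(\<Prod>v\<in>verts G. degree_factor (degree G v)) \<le> omega n m \<and>
    ((\<Prod>v\<in>verts G. degree_factor (degree G v)) = omega n m \<longleftrightarrow> almost_regular G)"
  proof (cases "\<exists>v\<in>verts G. degree G v = 0")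
    case True
    then have "(\<Prod>v\<in>verts G. degree_factor (degree G v)) = 0"
      using fin by (intro prod_zero) (auto simp: degree_factor_def)
    moreover have "\<not> almost_regular G"
      using True a unfolding almost_regular_iff[OF G(1) nm(1) G(2,3)] a_def[symmetric] by force
    ultimately show ?thesis by (simp add: om)
  next
    case False
    then have pos: "0 < degree G v" if "v \<in> verts G" for v using that by auto
    define S where "S = (\<Sum>v\<in>verts G. ln_fact_root (degree G v))"
    have prod: "(\<Prod>v\<in>verts G. degree_factor (degree G v)) = exp (S / 2)"
      unfolding S_def using fin pos by (rule prod_degree_factor)
    have le: "ln_fact_root (degree G v) \<le> T (degree G v)" if "v \<in> verts G" for v
      unfolding T_def using a pos[OF that] by (rule ln_fact_root_tangent(1))
    have "S \<le> 2 * E" unfolding S_def T[symmetric] using le by (rule sum_mono)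
    moreover have "S = 2 * E \<longleftrightarrow> almost_regular G"
    proof
      assume eq: "S = 2 * E"
      have "ln_fact_root (degree G v) = T (degree G v)" if "v \<in> verts G" for v
      proof (rule ccontr)
        assume "ln_fact_root (degree G v) \<noteq> T (degree G v)"
        then have "S < 2 * E" unfolding S_def T[symmetric]
          using le that fin by (intro sum_strict_mono_ex1) (auto simp: less_le)
        then show False using eq by simp
      qed
      then show "almost_regular G"
        unfolding almost_regular_iff[OF G(1) nm(1) G(2,3)] a_def[symmetric]
        using ln_fact_root_tangent(2)[OF a] pos by (simp add: T_def)
    next
      assume "almost_regular G"
      then have "ln_fact_root (degree G v) = T (degree G v)" if "v \<in> verts G" for v
        using that unfolding almost_regular_iff[OF G(1) nm(1) G(2,3)] a_def[symmetric]
        by (auto simp: T_def)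
      then show "S = 2 * E" unfolding S_def T[symmetric] by (rule sum.cong[OF refl])
    qed
    ultimately show ?thesis unfolding prod om by (simp add: mult.commute)
  qed
  then show "(\<Prod>v\<in>verts G. degree_factor (degree G v)) \<le> omega n m"
    "(\<Prod>v\<in>verts G. degree_factor (degree G v)) = omega n m \<longleftrightarrow> almost_regular G" by blast+
qed

section \<open>Graph isomorphisms and the maximum\<close>

definition relabel :: "('a \<Rightarrow> 'b) \<Rightarrow> 'a sgraph \<Rightarrow> 'b sgraph" where
  "relabel f G = (f ` verts G, (\<lambda>e. f ` e) ` edges G)"

lemma graph_iso_iff_relabel: "graph_iso G H \<longleftrightarrow> (\<exists>f. inj_on f (verts G) \<and> H = relabel f G)"
  unfolding graph_iso_def relabel_def bij_betw_def prod_eq_iff by auto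

lemma graph_iso_relabel: "inj_on f (verts G) \<Longrightarrow> graph_iso G (relabel f G)"
  unfolding graph_iso_iff_relabel by blast

lemma graph_isoE:
  assumes "graph_iso G H" obtains f where "inj_on f (verts G)" "H = relabel f G"
  using assms unfolding graph_iso_iff_relabel by blast

lemma edges_Pow: "fin_graph G \<Longrightarrow> edges G \<subseteq> Pow (verts G)"
  by (auto simp: fin_graph_def nsets_def)

text \<open>\<open>fin_graph\<close> enters because an inverse of f undoes f only inside the vertex
  set, where the edges must therefore lie.\<close>

lemma graph_iso_sym:
  assumes "fin_graph G" "graph_iso G H" shows "graph_iso H G"
proof -
  obtain f where f: "inj_on f (verts G)" "H = relabel f G" using assms(2) graph_iso_iff_relabel by blast
  define g where "g = inv_into (verts G) f"
  have "g ` f ` e = e" if "e \<subseteq> verts G" for e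
    unfolding g_def using f(1) that by (rule inv_into_image_cancel)
  then have "g ` f ` verts G = verts G" "(\<lambda>e. g ` f ` e) ` edges G = (\<lambda>e. e) ` edges G"
    using edges_Pow[OF assms(1)] by (blast, intro image_cong) auto
  then have "relabel g H = G"
    unfolding f(2) by (simp add: relabel_def image_image)
  moreover have "inj_on g (verts H)"
    unfolding f(2) relabel_def fst_conv g_def by (rule inj_on_inv_into) simp
  ultimately show ?thesis unfolding graph_iso_iff_relabel by metis
qed

lemma relabel_relabel: "relabel g (relabel f G) = relabel (g \<circ> f) G"
  by (simp add: relabel_def image_comp comp_def)

lemma graph_iso_trans:
  assumes "graph_iso G H" "graph_iso H K" shows "graph_iso G K"
proof -
  obtain f g where fg: "inj_on f (verts G)" "H = relabel f G" "inj_on g (verts H)" "K = relabel g H"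
    using assms by (metis graph_isoE)
  then have "inj_on (g \<circ> f) (verts G)" by (simp add: relabel_def comp_inj_on)
  then show ?thesis using graph_iso_relabel[of "g \<circ> f" G] fg by (simp add: relabel_relabel)
qed

lemma inj_on_image_edges:
  assumes "fin_graph G" "inj_on f (verts G)" shows "inj_on (\<lambda>e. f ` e) (edges G)"
  using inj_on_subset[OF inj_on_image_Pow[OF assms(2)] edges_Pow[OF assms(1)]] .

lemma relabel_simple:
  assumes "fin_graph G" "inj_on f (verts G)"
  shows "fin_graph (relabel f G)" "card (verts (relabel f G)) = card (verts G)"
    "card (edges (relabel f G)) = card (edges G)"
proof -
  have "f ` e \<in> nsets (f ` verts G) 2" if "e \<in> edges G" for e
  proof -
    have e: "e \<subseteq> verts G" "finite e" "card e = 2" using assms(1) that by (auto simp: fin_graph_def nsets_def)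
    then have "card (f ` e) = 2" using inj_on_subset[OF assms(2)] by (simp add: card_image)
    then show ?thesis using e by (auto simp: nsets_def)
  qed
  then show "fin_graph (relabel f G)" using assms(1) by (auto simp: fin_graph_def relabel_def)
  show "card (verts (relabel f G)) = card (verts G)" using assms by (simp add: relabel_def card_image)
  show "card (edges (relabel f G)) = card (edges G)"
    using inj_on_image_edges[OF assms] by (simp add: relabel_def card_image)
qed

lemma graph_iso_simple_graphs:
  assumes "graph_iso G H" "G \<in> simple_graphs N m" shows "H \<in> simple_graphs N m"
proof -
  obtain f where f: "inj_on f (verts G)" "H = relabel f G" using assms(1) graph_iso_iff_relabel by blast
  have G: "fin_graph G" using assms(2) by (simp add: simple_graphs_iff)
  show ?thesis using relabel_simple[OF G f(1)] f(2) assms(2) by (simp add: simple_graphs_iff)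
qed

text \<open>One inequality is enough, since \<open>perfmat_iso\<close> uses it in both
  directions.\<close>

lemma perfmat_relabel_le:
  assumes G: "fin_graph G" and f: "inj_on f (verts G)" shows "perfmat G \<le> perfmat (relabel f G)"
  unfolding perfmat_def
proof (rule card_inj_on_le[where f = "\<lambda>M. (\<lambda>e. f ` e) ` M"])
  have PE: "M \<subseteq> edges G" if "perfect_matching G M" for M using that by (simp add: perfect_matching_def)
  show "inj_on (\<lambda>M. (\<lambda>e. f ` e) ` M) {M. perfect_matching G M}"
    by (rule inj_on_subset[OF inj_on_image_Pow[OF inj_on_image_edges[OF G f]]]) (use PE in blast)
  show "(\<lambda>M. (\<lambda>e. f ` e) ` M) ` {M. perfect_matching G M} \<subseteq> {M. perfect_matching (relabel f G) M}"
  proof (rule image_subsetI, rule CollectI)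
    fix M assume "M \<in> {M. perfect_matching G M}"
    then have M: "M \<subseteq> edges G" "\<And>v. v \<in> verts G \<Longrightarrow> \<exists>!e. e \<in> M \<and> v \<in> e"
      by (simp_all add: perfect_matching_def)
    have mem: "f v \<in> f ` e \<longleftrightarrow> v \<in> e" if "v \<in> verts G" "e \<in> M" for v e
    proof (rule inj_on_image_mem_iff[OF f that(1)])
      show "e \<subseteq> verts G" using that(2) M(1) edges_Pow[OF G] by blast
    qed
    show "perfect_matching (relabel f G) ((\<lambda>e. f ` e) ` M)"
      unfolding perfect_matching_def
    proof (intro conjI ballI)
      show "(\<lambda>e. f ` e) ` M \<subseteq> edges (relabel f G)" using M(1) by (auto simp: relabel_def)
      fix w assume "w \<in> verts (relabel f G)"
      then obtain v where v: "v \<in> verts G" "w = f v" by (auto simp: relabel_def)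
      obtain e where e: "e \<in> M" "v \<in> e" and uniq: "\<And>e'. e' \<in> M \<Longrightarrow> v \<in> e' \<Longrightarrow> e' = e"
        using M(2)[OF v(1)] by blast
      show "\<exists>!e. e \<in> (\<lambda>e. f ` e) ` M \<and> w \<in> e"
      proof (rule ex1I[of _ "f ` e"])
        show "f ` e \<in> (\<lambda>e. f ` e) ` M \<and> w \<in> f ` e" using e v by blast
        fix e' assume e': "e' \<in> (\<lambda>e. f ` e) ` M \<and> w \<in> e'"
        then obtain d where d: "d \<in> M" "e' = f ` d" by (elim conjE imageE)
        then have "f v \<in> f ` d" using v(2) e' by simp
        then show "e' = f ` e" using mem[OF v(1) d(1)] uniq[OF d(1)] d(2) by simp
      qed
    qed
  qed
  have "{M. perfect_matching (relabel f G) M} \<subseteq> Pow (edges (relabel f G))"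
    by (auto simp: perfect_matching_def)
  then show "finite {M. perfect_matching (relabel f G) M}"
    using finite_edges[OF relabel_simple(1)[OF G f]] by (simp add: finite_subset)
qed

lemma perfmat_iso:
  assumes "fin_graph G" "graph_iso G H" shows "perfmat G = perfmat H"
proof (rule antisym)
  obtain f where f: "inj_on f (verts G)" "H = relabel f G" using assms(2) by (rule graph_isoE)
  show "perfmat G \<le> perfmat H" unfolding f(2) by (rule perfmat_relabel_le[OF assms(1) f(1)])
  have H: "fin_graph H" unfolding f(2) by (rule relabel_simple(1)[OF assms(1) f(1)])
  obtain g where g: "inj_on g (verts H)" "G = relabel g H"
    using graph_iso_sym[OF assms] by (rule graph_isoE)
  show "perfmat H \<le> perfmat G" unfolding g(2) by (rule perfmat_relabel_le[OF H g(1)])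
qed

section \<open>The maximum \<open>mu\<close> and graphs over other vertex types\<close>

lemma exists_nat_copy:
  fixes G :: "'a sgraph" assumes "G \<in> simple_graphs N m"
  shows "\<exists>H \<in> (simple_graphs N m :: nat sgraph set). graph_iso G H"
proof -
  have "finite (verts G)" using assms by (simp add: simple_graphs_def)
  from finite_imp_inj_to_nat_seg[OF this] obtain f :: "'a \<Rightarrow> nat" where "inj_on f (verts G)" by metis
  then show ?thesis using graph_iso_relabel graph_iso_simple_graphs[OF _ assms] by blast
qed

lemma perfmat_le_mu:
  fixes G :: "'a sgraph" assumes "G \<in> simple_graphs (2 * n) m" shows "perfmat G \<le> mu n m"
proof -
  obtain H :: "nat sgraph" where H: "H \<in> simple_graphs (2 * n) m" "graph_iso G H"
    using exists_nat_copy[OF assms] by blast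
  have "perfmat G = perfmat H" using perfmat_iso[OF _ H(2)] assms by (simp add: simple_graphs_iff)
  then show ?thesis unfolding mu_def using H(1) finite_perfmat_image by (auto intro: Max_ge)
qed

lemma simple_graphs_nonempty:
  assumes "m \<le> N choose 2" shows "(simple_graphs N m :: nat sgraph set) \<noteq> {}"
proof -
  have "m \<le> card (nsets {..<N} 2)" using assms by (simp add: card_nsets)
  then obtain E where "E \<subseteq> nsets {..<N} 2" "card E = m" by (metis obtain_subset_with_card_n)
  then have "({..<N}, E) \<in> simple_graphs N m" by (simp add: simple_graphs_def)
  then show ?thesis by blast
qed

lemma mu_attained:
  assumes "m \<le> (2 * n) choose 2"
  shows "\<exists>G \<in> (simple_graphs (2 * n) m :: nat sgraph set). perfmat G = mu n m"
proof -
  have "mu n m \<in> perfmat ` (simple_graphs (2 * n) m :: nat sgraph set)"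
    unfolding mu_def using simple_graphs_nonempty[OF assms] by (intro Max_in finite_perfmat_image) simp
  then show ?thesis by force
qed

section \<open>Sizes of unions of complete bipartite graphs\<close>

lemma complete_bipartite_simple:
  "fin_graph (complete_bipartite r s)" "card (verts (complete_bipartite r s)) = r + s"
  "card (edges (complete_bipartite r s)) = r * s"
proof -
  have e: "edges (complete_bipartite r s) = (\<lambda>(i, j). {Inl i, Inr j}) ` ({..<r} \<times> {..<s})"
    by (auto simp: complete_bipartite_def)
  have "inj_on (\<lambda>(i, j). {Inl i, Inr j}) ({..<r} \<times> {..<s})"
    by (auto simp: inj_on_def doubleton_eq_iff)
  then show "card (edges (complete_bipartite r s)) = r * s"
    unfolding e by (simp add: card_image card_cartesian_product)
  show "fin_graph (complete_bipartite r s)"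
    by (auto simp: fin_graph_def complete_bipartite_def nsets_def)
  show "card (verts (complete_bipartite r s)) = r + s"
    by (simp add: complete_bipartite_def card_Plus)
qed

lemma edge_nonempty: "fin_graph G \<Longrightarrow> e \<in> edges G \<Longrightarrow> e \<noteq> {}"
  by (auto simp: fin_graph_def nsets_def)

lemma disjoint_union_simple:
  fixes G :: "'a sgraph" and H :: "'b sgraph"
  assumes "fin_graph G" "fin_graph H"
  shows "fin_graph (disjoint_union G H)"
    "card (verts (disjoint_union G H)) = card (verts G) + card (verts H)"
    "card (edges (disjoint_union G H)) = card (edges G) + card (edges H)"
proof -
  have "inj_on (Inl :: 'a \<Rightarrow> 'a + 'b) (verts G)" "inj_on (Inr :: 'b \<Rightarrow> 'a + 'b) (verts H)"
    by (auto simp: inj_on_def)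
  note l = relabel_simple[OF assms(1) this(1)] and r = relabel_simple[OF assms(2) this(2)]
  have v: "verts (disjoint_union G H) = verts (relabel Inl G) \<union> verts (relabel Inr H)"
    by (auto simp: disjoint_union_def relabel_def)
  have e: "edges (disjoint_union G H) = edges (relabel Inl G) \<union> edges (relabel Inr H)"
    by (simp add: disjoint_union_def relabel_def)
  show "fin_graph (disjoint_union G H)"
    using l(1) r(1) unfolding fin_graph_def v e by (auto simp: nsets_def)
  show "card (verts (disjoint_union G H)) = card (verts G) + card (verts H)"
    using assms by (simp add: disjoint_union_def card_Plus fin_graph_def)
  have "edges (relabel Inl G) \<inter> edges (relabel Inr H) = {}"
  proof (rule ccontr)
    assume "edges (relabel Inl G) \<inter> edges (relabel Inr H) \<noteq> {}"
    then obtain x y where "x \<in> edges G" "Inl ` x = (Inr ` y :: ('a + 'b) set)"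
      by (auto simp: relabel_def)
    moreover from this have "x \<noteq> {}" using edge_nonempty[OF assms(1)] by blast
    ultimately show False by blast
  qed
  then show "card (edges (disjoint_union G H)) = card (edges G) + card (edges H)"
    unfolding e using l(3) r(3) finite_edges[OF l(1)] finite_edges[OF r(1)] by (simp add: card_Un_disjoint)
qed

text \<open>The empty set has the same image under every \<open>Pair i\<close>. Edges are nonempty,
  so their copies stay distinct.\<close>

lemma Pair_image_eq_iff:
  assumes "e \<noteq> {}" shows "Pair i ` e = Pair j ` e' \<longleftrightarrow> i = j \<and> e = e'"
proof
  assume eq: "Pair i ` e = Pair j ` e'"
  obtain x where "x \<in> e" using assms by blast
  then have "(i, x) \<in> Pair j ` e'" unfolding eq[symmetric] by (rule imageI)
  then have "i = j" by (elim imageE) simp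
  then have "snd ` Pair j ` e = snd ` Pair j ` e'" using eq by simp
  then have "e = e'" by (simp add: image_image)
  with \<open>i = j\<close> show "i = j \<and> e = e'" ..
qed simp

lemma copies_simple:
  assumes "fin_graph G"
  shows "fin_graph (copies l G)" "card (verts (copies l G)) = l * card (verts G)"
    "card (edges (copies l G)) = l * card (edges G)"
proof -
  have e: "edges (copies l G) = (\<lambda>(i, e). Pair i ` e) ` ({..<l} \<times> edges G)"
    by (auto simp: copies_def)
  have "inj_on (\<lambda>(i, e). Pair i ` e) ({..<l} \<times> edges G)"
  proof (rule inj_onI)
    fix p q assume p: "p \<in> {..<l} \<times> edges G" "q \<in> {..<l} \<times> edges G"
      and eq: "(case p of (i, e) \<Rightarrow> Pair i ` e) = (case q of (i, e) \<Rightarrow> Pair i ` e)"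
    have ne: "snd p \<noteq> {}" using p(1) edge_nonempty[OF assms] by auto
    have "Pair (fst p) ` snd p = Pair (fst q) ` snd q" using eq by (simp add: case_prod_beta)
    then show "p = q" unfolding Pair_image_eq_iff[OF ne] by (simp add: prod_eq_iff)
  qed
  then show "card (edges (copies l G)) = l * card (edges G)"
    unfolding e by (simp add: card_image card_cartesian_product)
  show "card (verts (copies l G)) = l * card (verts G)"
    by (simp add: copies_def card_cartesian_product)
  have "edges (copies l G) \<subseteq> nsets (verts (copies l G)) 2"
  proof
    fix d assume "d \<in> edges (copies l G)"
    then obtain i x where x: "i < l" "x \<in> edges G" "d = Pair i ` x" by (auto simp: copies_def)
    then have "x \<subseteq> verts G" "finite x" "card x = 2" using assms by (auto simp: fin_graph_def nsets_def)
    then show "d \<in> nsets (verts (copies l G)) 2"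
      using x by (auto simp: nsets_def copies_def card_image inj_on_def)
  qed
  then show "fin_graph (copies l G)" using assms by (auto simp: fin_graph_def copies_def)
qed

lemma bipartite_union_simple:
  "bipartite_union l1 l2 r \<in> simple_graphs (2 * (l1 * r + l2 * (r + 1))) (l1 * r\<^sup>2 + l2 * (r + 1)\<^sup>2)"
  unfolding simple_graphs_iff bipartite_union_def
  by (simp add: disjoint_union_simple copies_simple complete_bipartite_simple power2_eq_square algebra_simps)

section \<open>Perfect matchings of unions of complete bipartite graphs\<close>

lemma finite_perfect_matchings: "fin_graph G \<Longrightarrow> finite {M. perfect_matching G M}"
  by (rule finite_subset[of _ "Pow (edges G)"]) (auto simp: perfect_matching_def finite_edges)

text \<open>Each permutation p gives the matching that joins i on the left to p i on the right. This
  and the next bounds are only lower ones, since \<open>perfmat_le_omega\<close> closes the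
  gap.\<close>

lemma perfmat_complete_bipartite_ge: "fact r \<le> perfmat (complete_bipartite r r)"
proof -
  define K where "K = complete_bipartite r r"
  define F where "F p = (\<lambda>i. {Inl i, Inr (p i)}) ` {..<r}" for p :: "nat \<Rightarrow> nat"
  have "card {p. p permutes {..<r}} \<le> card {M. perfect_matching K M}"
  proof (rule card_inj_on_le[of F])
    show "inj_on F {p. p permutes {..<r}}"
    proof (rule inj_onI)
      fix p q assume p: "p \<in> {p. p permutes {..<r}}" and q: "q \<in> {p. p permutes {..<r}}" and eq: "F p = F q"
      show "p = q"
      proof
        fix i
        show "p i = q i"
        proof (cases "i < r")
          case True
          then have "{Inl i, Inr (p i)} \<in> F p" by (simp add: F_def)
          then have "{Inl i, Inr (p i)} \<in> F q" unfolding eq .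
          then show ?thesis by (auto simp: F_def doubleton_eq_iff)
        next
          case False
          then show ?thesis using p q by (simp add: permutes_def)
        qed
      qed
    qed
    show "F ` {p. p permutes {..<r}} \<subseteq> {M. perfect_matching K M}"
    proof (rule image_subsetI, rule CollectI)
      fix p assume "p \<in> {p. p permutes {..<r}}"
      then have p: "p permutes {..<r}" by simp
      have lt: "p i < r" if "i < r" for i using permutes_in_image[OF p, of i] that by simp
      show "perfect_matching K (F p)"
        unfolding perfect_matching_def
      proof (intro conjI ballI)
        show "F p \<subseteq> edges K" using lt by (auto simp: F_def K_def complete_bipartite_def)
        fix v assume "v \<in> verts K"
        then consider i where "v = Inl i" "i < r" | j where "v = Inr j" "j < r"
          by (auto simp: K_def complete_bipartite_def)
        then show "\<exists>!e. e \<in> F p \<and> v \<in> e"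
        proof cases
          case (1 i)
          then show ?thesis by (intro ex1I[of _ "{Inl i, Inr (p i)}"]) (auto simp: F_def)
        next
          case (2 j)
          then have "j \<in> p ` {..<r}" using permutes_image[OF p] by simp
          then obtain i where i: "i < r" "j = p i" by blast
          have "i' = i" if "p i' = p i" for i' using permutes_inj[OF p] that by (simp add: inj_eq)
          with 2 i show ?thesis by (intro ex1I[of _ "{Inl i, Inr (p i)}"]) (auto simp: F_def)
        qed
      qed
    qed
    show "finite {M. perfect_matching K M}"
      unfolding K_def by (intro finite_perfect_matchings complete_bipartite_simple)
  qed
  then show ?thesis by (simp add: card_permutations perfmat_def K_def)
qed

lemma perfmat_disjoint_union_ge:
  fixes G :: "'a sgraph" and H :: "'b sgraph"
  assumes "fin_graph G" "fin_graph H"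
  shows "perfmat G * perfmat H \<le> perfmat (disjoint_union G H)"
proof -
  define F :: "'a set set \<times> 'b set set \<Rightarrow> ('a + 'b) set set"
    where "F p = (\<lambda>e. Inl ` e) ` fst p \<union> (\<lambda>e. Inr ` e) ` snd p" for p
  \<comment> \<open>A left inverse of F on pairs of matchings. The images of an edge of G and an
    edge of H cannot coincide, because edges are nonempty.\<close>
  define B :: "('a + 'b) set set \<Rightarrow> 'a set set \<times> 'b set set"
    where "B M = ({e \<in> edges G. Inl ` e \<in> M}, {e \<in> edges H. Inr ` e \<in> M})" for M
  have LR: "(Inl ` x :: ('a + 'b) set) \<noteq> Inr ` y" if "x \<noteq> {} \<or> y \<noteq> {}" for x y
    using that by blast
  have injL: "(Inl ` x :: ('a + 'b) set) = Inl ` y \<longleftrightarrow> x = y" for x y :: "'a set"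
    by (simp add: inj_image_eq_iff)
  have injR: "(Inr ` x :: ('a + 'b) set) = Inr ` y \<longleftrightarrow> x = y" for x y :: "'b set"
    by (simp add: inj_image_eq_iff)
  have "card ({M. perfect_matching G M} \<times> {M. perfect_matching H M})
      \<le> card {M. perfect_matching (disjoint_union G H) M}"
  proof (rule card_inj_on_le[of F])
    show "inj_on F ({M. perfect_matching G M} \<times> {M. perfect_matching H M})"
    proof (rule inj_on_inverseI[of _ B])
      fix p assume p: "p \<in> {M. perfect_matching G M} \<times> {M. perfect_matching H M}"
      then have sub: "fst p \<subseteq> edges G" "snd p \<subseteq> edges H" by (auto simp: perfect_matching_def)
      have "Inl ` e \<in> F p \<longleftrightarrow> e \<in> fst p" if "e \<in> edges G" for e
        using LR[of e] injL edge_nonempty[OF assms(1) that] by (auto simp: F_def image_iff)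
      moreover have "Inr ` e \<in> F p \<longleftrightarrow> e \<in> snd p" if "e \<in> edges H" for e
        using LR[of _ e] injR edge_nonempty[OF assms(2) that] by (auto simp: F_def image_iff)
      ultimately show "B (F p) = p"
        using sub unfolding B_def prod_eq_iff fst_conv snd_conv by blast
    qed
    show "F ` ({M. perfect_matching G M} \<times> {M. perfect_matching H M})
        \<subseteq> {M. perfect_matching (disjoint_union G H) M}"
    proof (rule image_subsetI, rule CollectI)
      fix p assume "p \<in> {M. perfect_matching G M} \<times> {M. perfect_matching H M}"
      then have "perfect_matching G (fst p)" "perfect_matching H (snd p)" by auto
      then have p: "fst p \<subseteq> edges G" "\<And>v. v \<in> verts G \<Longrightarrow> \<exists>!e. e \<in> fst p \<and> v \<in> e"
        "snd p \<subseteq> edges H" "\<And>v. v \<in> verts H \<Longrightarrow> \<exists>!e. e \<in> snd p \<and> v \<in> e"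
        by (simp_all add: perfect_matching_def)
      show "perfect_matching (disjoint_union G H) (F p)"
        unfolding perfect_matching_def
      proof (intro conjI ballI)
        show "F p \<subseteq> edges (disjoint_union G H)" using p(1,3) by (auto simp: F_def disjoint_union_def)
        fix v assume "v \<in> verts (disjoint_union G H)"
        then consider x where "v = Inl x" "x \<in> verts G" | x where "v = Inr x" "x \<in> verts H"
          by (auto simp: disjoint_union_def)
        then show "\<exists>!e. e \<in> F p \<and> v \<in> e"
        proof cases
          case (1 x)
          obtain e where e: "e \<in> fst p" "x \<in> e" and u: "\<And>e'. e' \<in> fst p \<Longrightarrow> x \<in> e' \<Longrightarrow> e' = e"
            using p(2)[OF 1(2)] by blast
          show ?thesis
          proof (rule ex1I[of _ "Inl ` e"])
            show "Inl ` e \<in> F p \<and> v \<in> Inl ` e" using e 1 by (simp add: F_def)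
            fix d assume "d \<in> F p \<and> v \<in> d"
            then obtain e' where "e' \<in> fst p" "d = Inl ` e'" "x \<in> e'" using 1 by (auto simp: F_def)
            then show "d = Inl ` e" using u by simp
          qed
        next
          case (2 x)
          obtain e where e: "e \<in> snd p" "x \<in> e" and u: "\<And>e'. e' \<in> snd p \<Longrightarrow> x \<in> e' \<Longrightarrow> e' = e"
            using p(4)[OF 2(2)] by blast
          show ?thesis
          proof (rule ex1I[of _ "Inr ` e"])
            show "Inr ` e \<in> F p \<and> v \<in> Inr ` e" using e 2 by (simp add: F_def)
            fix d assume "d \<in> F p \<and> v \<in> d"
            then obtain e' where "e' \<in> snd p" "d = Inr ` e'" "x \<in> e'" using 2 by (auto simp: F_def)
            then show "d = Inr ` e" using u by simp
          qed
        qed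
      qed
    qed
    show "finite {M. perfect_matching (disjoint_union G H) M}"
      by (intro finite_perfect_matchings disjoint_union_simple assms)
  qed
  then show ?thesis by (simp add: card_cartesian_product perfmat_def)
qed

lemma perfmat_copies_ge:
  fixes G :: "'a sgraph"
  assumes "fin_graph G" shows "perfmat G ^ l \<le> perfmat (copies l G)"
proof -
  define F :: "(nat \<Rightarrow> 'a set set) \<Rightarrow> (nat \<times> 'a) set set"
    where "F m = (\<Union>i<l. (\<lambda>e. Pair i ` e) ` m i)" for m
  define B :: "(nat \<times> 'a) set set \<Rightarrow> nat \<Rightarrow> 'a set set"
    where "B M = (\<lambda>i\<in>{..<l}. {e \<in> edges G. Pair i ` e \<in> M})" for M
  have "card ({..<l} \<rightarrow>\<^sub>E {M. perfect_matching G M}) \<le> card {M. perfect_matching (copies l G) M}"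
  proof (rule card_inj_on_le[of F])
    show "inj_on F ({..<l} \<rightarrow>\<^sub>E {M. perfect_matching G M})"
    proof (rule inj_on_inverseI[of _ B])
      fix m assume m: "m \<in> {..<l} \<rightarrow>\<^sub>E {M. perfect_matching G M}"
      have sub: "m i \<subseteq> edges G" if "i < l" for i
        using PiE_mem[OF m, of i] that by (simp add: perfect_matching_def)
      have val: "Pair i ` e \<in> F m \<longleftrightarrow> e \<in> m i" if "i < l" "e \<in> edges G" for i e
      proof
        assume "Pair i ` e \<in> F m"
        then obtain j d where j: "j < l" "d \<in> m j" "Pair i ` e = Pair j ` d" by (auto simp: F_def)
        have "i = j \<and> e = d" using j(3) unfolding Pair_image_eq_iff[OF edge_nonempty[OF assms that(2)]] .
        then show "e \<in> m i" using j by simp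
      qed (use that in \<open>auto simp: F_def\<close>)
      show "B (F m) = m"
      proof (rule extensionalityI[of _ "{..<l}"])
        show "m \<in> extensional {..<l}" using m by (simp add: PiE_iff)
        fix i assume "i \<in> {..<l}"
        then show "B (F m) i = m i" using val[of i] sub[of i] by (auto simp: B_def)
      qed (simp add: B_def)
    qed
    show "F ` ({..<l} \<rightarrow>\<^sub>E {M. perfect_matching G M}) \<subseteq> {M. perfect_matching (copies l G) M}"
    proof (rule image_subsetI, rule CollectI)
      fix m assume m: "m \<in> {..<l} \<rightarrow>\<^sub>E {M. perfect_matching G M}"
      have pm: "perfect_matching G (m i)" if "i < l" for i using PiE_mem[OF m, of i] that by simp
      show "perfect_matching (copies l G) (F m)"
        unfolding perfect_matching_def
      proof (intro conjI ballI)
        show "F m \<subseteq> edges (copies l G)"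
          using pm by (auto simp: F_def copies_def perfect_matching_def)
        fix v assume "v \<in> verts (copies l G)"
        then obtain i x where v: "v = (i, x)" "i < l" "x \<in> verts G" by (auto simp: copies_def)
        have "\<exists>!e. e \<in> m i \<and> x \<in> e" using pm[OF v(2)] v(3) by (simp add: perfect_matching_def)
        then obtain e where e: "e \<in> m i" "x \<in> e" and u: "\<And>e'. e' \<in> m i \<Longrightarrow> x \<in> e' \<Longrightarrow> e' = e"
          by blast
        show "\<exists>!e. e \<in> F m \<and> v \<in> e"
        proof (rule ex1I[of _ "Pair i ` e"])
          show "Pair i ` e \<in> F m \<and> v \<in> Pair i ` e" using e v by (auto simp: F_def)
          fix d assume "d \<in> F m \<and> v \<in> d"
          then obtain e' where "e' \<in> m i" "d = Pair i ` e'" "x \<in> e'" using v by (auto simp: F_def)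
          then show "d = Pair i ` e" using u by simp
        qed
      qed
    qed
    show "finite {M. perfect_matching (copies l G) M}"
      by (intro finite_perfect_matchings copies_simple assms)
  qed
  then show ?thesis by (simp add: card_PiE perfmat_def)
qed

lemma perfmat_bipartite_union_ge:
  "fact r ^ l1 * fact (r + 1) ^ l2 \<le> perfmat (bipartite_union l1 l2 r)"
proof -
  have *: "fact s ^ l \<le> perfmat (copies l (complete_bipartite s s))" for s l
    using power_mono[OF perfmat_complete_bipartite_ge[of s], of l]
      perfmat_copies_ge[OF complete_bipartite_simple(1)[of s s], of l] by linarith
  have "fact r ^ l1 * fact (r + 1) ^ l2 \<le>
      perfmat (copies l1 (complete_bipartite r r)) * perfmat (copies l2 (complete_bipartite (r + 1) (r + 1)))"
    by (rule mult_le_mono[OF * *])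
  also have "\<dots> \<le> perfmat (bipartite_union l1 l2 r)"
    unfolding bipartite_union_def by (intro perfmat_disjoint_union_ge copies_simple complete_bipartite_simple)
  finally show ?thesis .
qed

section \<open>Recognising unions of complete bipartite graphs\<close>

lemma graph_iso_join:
  assumes "edges G1 \<subseteq> Pow (verts G1)" "edges G2 \<subseteq> Pow (verts G2)" "verts G1 \<inter> verts G2 = {}"
    and "graph_iso G1 H1" "graph_iso G2 H2" "verts H1 \<inter> verts H2 = {}"
  shows "graph_iso (verts G1 \<union> verts G2, edges G1 \<union> edges G2) (verts H1 \<union> verts H2, edges H1 \<union> edges H2)"
proof -
  obtain f where f: "bij_betw f (verts G1) (verts H1)" "edges H1 = (\<lambda>e. f ` e) ` edges G1"
    using assms(4) unfolding graph_iso_def by (elim exE conjE)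
  obtain g where g: "bij_betw g (verts G2) (verts H2)" "edges H2 = (\<lambda>e. g ` e) ` edges G2"
    using assms(5) unfolding graph_iso_def by (elim exE conjE)
  define h where "h x = (if x \<in> verts G1 then f x else g x)" for x
  have hf: "h x = f x" if "x \<in> verts G1" for x using that by (simp add: h_def)
  have hg: "h x = g x" if "x \<in> verts G2" for x using that assms(3) by (auto simp: h_def)
  have "bij_betw h (verts G1) (verts H1)" "bij_betw h (verts G2) (verts H2)"
    using f(1) g(1) bij_betw_cong[of _ h f, OF hf] bij_betw_cong[of _ h g, OF hg] by blast+
  then have "bij_betw h (verts G1 \<union> verts G2) (verts H1 \<union> verts H2)"
    using assms(6) by (rule bij_betw_combine)
  moreover have "(\<lambda>e. h ` e) ` edges G1 = edges H1"
    unfolding f(2)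
  proof (rule image_cong[OF refl])
    fix e assume "e \<in> edges G1"
    then have "e \<subseteq> verts G1" using assms(1) by blast
    then show "h ` e = f ` e" using hf by (intro image_cong[OF refl]) blast
  qed
  moreover have "(\<lambda>e. h ` e) ` edges G2 = edges H2"
    unfolding g(2)
  proof (rule image_cong[OF refl])
    fix e assume "e \<in> edges G2"
    then have "e \<subseteq> verts G2" using assms(2) by blast
    then show "h ` e = g ` e" using hg by (intro image_cong[OF refl]) blast
  qed
  ultimately show ?thesis unfolding graph_iso_def fst_conv snd_conv image_Un by metis
qed

lemma graph_iso_complete_bipartite:
  assumes "finite S" "finite T" "S \<inter> T = {}" "card S = r" "card T = s"
  shows "graph_iso (S \<union> T, {{x, y} | x y. x \<in> S \<and> y \<in> T}) (complete_bipartite r s)"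
proof -
  obtain p q where p: "bij_betw p S {..<r}" and q: "bij_betw q T {..<s}"
    using assms finite_same_card_bij[of S "{..<r}"] finite_same_card_bij[of T "{..<s}"] by auto
  define h where "h x = (if x \<in> S then Inl (p x) else Inr (q x))" for x
  have hS: "h x = Inl (p x)" if "x \<in> S" for x using that by (simp add: h_def)
  have hT: "h x = Inr (q x)" if "x \<in> T" for x using that assms(3) by (auto simp: h_def)
  have pi: "p ` S = {..<r}" "q ` T = {..<s}" using p q by (auto simp: bij_betw_def)
  have "inj_on h (S \<union> T)"
  proof (rule inj_onI)
    fix x y assume "x \<in> S \<union> T" "y \<in> S \<union> T" "h x = h y"
    then show "x = y" using p q unfolding bij_betw_def
      by (cases "x \<in> S"; cases "y \<in> S") (auto simp: hS hT dest: inj_onD)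
  qed
  moreover have "h ` (S \<union> T) = {..<r} <+> {..<s}"
    unfolding image_Un Plus_def pi[symmetric] image_image using hS hT by simp
  moreover have "{{Inl i, Inr j} | i j. i < r \<and> j < s} = (\<lambda>e. h ` e) ` {{x, y} | x y. x \<in> S \<and> y \<in> T}"
  proof (intro equalityI subsetI)
    fix e assume "e \<in> {{Inl i, Inr j :: nat + nat} | i j. i < r \<and> j < s}"
    then obtain i j where ij: "e = {Inl i, Inr j}" "i \<in> p ` S" "j \<in> q ` T" using pi by auto
    then obtain x y where xy: "x \<in> S" "y \<in> T" "i = p x" "j = q y" by blast
    have "e = h ` {x, y}" using ij xy hS hT by simp
    then show "e \<in> (\<lambda>e. h ` e) ` {{x, y} | x y. x \<in> S \<and> y \<in> T}" using xy by blast
  next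
    fix e assume "e \<in> (\<lambda>e. h ` e) ` {{x, y} | x y. x \<in> S \<and> y \<in> T}"
    then obtain x y where xy: "x \<in> S" "y \<in> T" "e = h ` {x, y}" by blast
    then have "p x < r" "q y < s" using pi by auto
    then show "e \<in> {{Inl i, Inr j} | i j. i < r \<and> j < s}" using xy hS hT by auto
  qed
  ultimately show ?thesis by (auto simp: graph_iso_def bij_betw_def complete_bipartite_def)
qed

text \<open>The new copy carries the next index, so that \<open>graph_iso_join\<close> can adjoin
  one component at a time.\<close>

lemma bipartite_union_Suc1:
  "bipartite_union (Suc l1) l2 r =
    (verts (bipartite_union l1 l2 r) \<union> verts (relabel (\<lambda>x. Inl (l1, x)) (complete_bipartite r r)),
     edges (bipartite_union l1 l2 r) \<union> edges (relabel (\<lambda>x. Inl (l1, x)) (complete_bipartite r r)))"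
  "verts (bipartite_union l1 l2 r) \<inter> verts (relabel (\<lambda>x. Inl (l1, x)) (complete_bipartite r r)) = {}"
  by (auto simp: bipartite_union_def disjoint_union_def copies_def relabel_def lessThan_Suc
      image_Un image_image Plus_def prod_eq_iff)

lemma bipartite_union_Suc2:
  "bipartite_union l1 (Suc l2) r =
    (verts (bipartite_union l1 l2 r) \<union> verts (relabel (\<lambda>x. Inr (l2, x)) (complete_bipartite (r + 1) (r + 1))),
     edges (bipartite_union l1 l2 r) \<union> edges (relabel (\<lambda>x. Inr (l2, x)) (complete_bipartite (r + 1) (r + 1))))"
  "verts (bipartite_union l1 l2 r) \<inter> verts (relabel (\<lambda>x. Inr (l2, x)) (complete_bipartite (r + 1) (r + 1))) = {}"
  by (auto simp: bipartite_union_def disjoint_union_def copies_def relabel_def lessThan_Suc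
      image_Un image_image Plus_def prod_eq_iff)

text \<open>Any w adjacent to u shares the neighbour u with v, hence has the neighbourhood of v. A
  placement thus maps the neighbours of u injectively to neighbours of v; by symmetry the numbers
  agree. This balances the components.\<close>

lemma placement_imp_nbr_degree_eq:
  assumes G: "fin_graph G" "blocks G" "placements (verts G) (verts G) (nbrs G) \<noteq> {}" and "u \<in> nbrs G v"
  shows "card (nbrs G u) = card (nbrs G v)"
proof -
  have fin: "finite (verts G)" using G by (simp add: fin_graph_def)
  obtain \<sigma> where s: "\<sigma> \<in> placements (verts G) (verts G) (nbrs G)" using G(3) by blast
  have le: "card (nbrs G u) \<le> card (nbrs G v)" if uv: "u \<in> nbrs G v" for u v
  proof (rule card_inj_on_le[of \<sigma>])
    have v: "v \<in> verts G" using uv nbrs_subset[OF G(1), of u] nbrs_sym[of u G v] by blast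
    show "inj_on \<sigma> (nbrs G u)"
      using s nbrs_subset[OF G(1), of u] by (auto simp: placements_def bij_betw_def intro: inj_on_subset)
    show "finite (nbrs G v)" using nbrs_subset[OF G(1), of v] fin by (rule finite_subset)
    show "\<sigma> ` nbrs G u \<subseteq> nbrs G v"
    proof (rule image_subsetI)
      fix w assume w: "w \<in> nbrs G u"
      then have wV: "w \<in> verts G" using nbrs_subset[OF G(1), of u] by blast
      have "u \<in> nbrs G w" using w nbrs_sym[of u G w] by simp
      then have "nbrs G w = nbrs G v" using G(2) uv wV v unfolding blocks_def by blast
      then show "\<sigma> w \<in> nbrs G v" using placements_value[OF s wV] by simp
    qed
  qed
  show ?thesis using le[OF assms(4)] le[of v u] assms(4) nbrs_sym[of u G v] by (simp add: antisym)
qed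

text \<open>Induction that peels off the component of a vertex v: S is its neighbourhood and T that
  of some u in S. Sharing u, all vertices of T have neighbourhood S; sharing v, all of S have
  neighbourhood T. A vertex in both would be its own neighbour.\<close>

lemma blocks_imp_bipartite_union:
  assumes "fin_graph G" "blocks G" "0 < a"
    and "\<And>u v. u \<in> nbrs G v \<Longrightarrow> card (nbrs G u) = card (nbrs G v)"
    and "\<And>v. v \<in> verts G \<Longrightarrow> card (nbrs G v) = a \<or> card (nbrs G v) = Suc a"
  shows "\<exists>l1 l2. graph_iso G (bipartite_union l1 l2 a)"
  using assms
proof (induction "card (verts G)" arbitrary: G rule: less_induct)
  case less
  note G = \<open>fin_graph G\<close>
  have fin: "finite (verts G)" using G by (simp add: fin_graph_def)
  show ?case
  proof (cases "verts G = {}")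
    case True
    then have "G = ({}, {})" using edges_Pow[OF G] G by (cases G) (auto simp: fin_graph_def nsets_def)
    moreover have "bipartite_union 0 0 a = ({}, {})"
      by (simp add: bipartite_union_def disjoint_union_def copies_def)
    ultimately have "graph_iso G (bipartite_union 0 0 a)" by (simp add: graph_iso_def bij_betw_def)
    then show ?thesis by blast
  next
    case False
    then obtain v where v: "v \<in> verts G" by blast
    define S where "S = nbrs G v"
    have "card S \<noteq> 0" using less.prems(5)[OF v] less.prems(3) by (auto simp: S_def)
    then obtain u where u: "u \<in> S" by fastforce
    define T where "T = nbrs G u"
    have SV: "S \<subseteq> verts G" and TV: "T \<subseteq> verts G" using nbrs_subset[OF G] by (auto simp: S_def T_def)
    have vT: "v \<in> T" using u nbrs_sym[of u G v] by (simp add: S_def T_def)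
    have eqI: "nbrs G x = nbrs G y" if "z \<in> nbrs G x" "z \<in> nbrs G y" "x \<in> verts G" "y \<in> verts G" for x y z
      using less.prems(2) that unfolding blocks_def by blast
    have nT: "nbrs G w = S" if "w \<in> T" for w
      unfolding S_def using that u v TV nbrs_sym[of u G w] by (intro eqI[of u]) (auto simp: S_def T_def)
    have nS: "nbrs G s = T" if "s \<in> S" for s
      unfolding T_def using that u v SV nbrs_sym[of s G v] nbrs_sym[of u G v] by (intro eqI[of v]) (auto simp: S_def)
    have disj: "S \<inter> T = {}" using nS nbrs_irrefl[OF G] by blast
    have cST: "card T = card S" using less.prems(4)[of u v] u by (simp add: S_def T_def)
    define U where "U = verts G - (S \<union> T)"
    define G' where "G' = (U, {e \<in> edges G. e \<subseteq> U})"
    have vG': "verts G' = U" by (simp add: G'_def)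
    have out: "nbrs G x \<subseteq> U" if "x \<in> U" for x
    proof
      fix y assume y: "y \<in> nbrs G x"
      have "y \<notin> S" using nS[of y] y nbrs_sym[of x G y] that by (auto simp: U_def)
      moreover have "y \<notin> T" using nT[of y] y nbrs_sym[of x G y] that by (auto simp: U_def)
      ultimately show "y \<in> U" using y nbrs_subset[OF G, of x] by (auto simp: U_def)
    qed
    have nG': "nbrs G' x = nbrs G x" if "x \<in> U" for x
      using out[OF that] that by (auto simp: nbrs_def G'_def)
    have G': "fin_graph G'" using G by (auto simp: fin_graph_def G'_def U_def nsets_def)
    have nG'': "x \<in> nbrs G' y \<Longrightarrow> x \<in> U \<and> y \<in> U" for x y by (auto simp: nbrs_def G'_def)
    have "\<exists>l1 l2. graph_iso G' (bipartite_union l1 l2 a)"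
    proof (rule less.hyps)
      show "card (verts G') < card (verts G)"
        unfolding vG' using fin vT v by (intro psubset_card_mono) (auto simp: U_def)
      show "blocks G'"
        using less.prems(2) nG' by (auto simp: blocks_def vG') (auto simp: U_def)
      show "card (nbrs G' x) = card (nbrs G' y)" if "x \<in> nbrs G' y" for x y
        using nG''[OF that] nG' less.prems(4)[of x y] that by simp
      show "card (nbrs G' x) = a \<or> card (nbrs G' x) = Suc a" if "x \<in> verts G'" for x
        using less.prems(5)[of x] nG'[of x] that by (simp add: vG') (auto simp: U_def)
    qed (use G' less.prems(3) in auto)
    then obtain l1 l2 where IH: "graph_iso G' (bipartite_union l1 l2 a)" by blast
    define K where "K = (S \<union> T, {{x, y} | x y. x \<in> S \<and> y \<in> T})"
    have edges: "edges G = edges G' \<union> edges K"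
    proof (intro equalityI subsetI)
      fix e assume e: "e \<in> edges G"
      obtain x y where xy: "e = {x, y}" "x \<in> verts G" "y \<in> verts G" using edgeE[OF G e] by metis
      have yx: "y \<in> nbrs G x" "x \<in> nbrs G y" using e xy(1) by (auto simp: nbrs_def insert_commute)
      consider "x \<in> S" | "x \<in> T" | "x \<in> U" using xy by (auto simp: U_def)
      then show "e \<in> edges G' \<union> edges K"
      proof cases
        case 1
        then have "y \<in> T" using nS yx by blast
        with 1 xy show ?thesis by (auto simp: K_def)
      next
        case 2
        then have "y \<in> S" using nT yx by blast
        then have "e \<in> edges K" using 2 xy(1) insert_commute[of x y] by (auto simp: K_def)
        then show ?thesis by blast
      next
        case 3
        then have "y \<in> U" using out yx by blast
        with 3 xy e show ?thesis by (auto simp: G'_def)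
      qed
    next
      fix e assume "e \<in> edges G' \<union> edges K"
      then show "e \<in> edges G"
      proof
        assume "e \<in> edges K"
        then obtain x y where "e = {x, y}" "x \<in> S" "y \<in> T" by (auto simp: K_def)
        moreover from this have "y \<in> nbrs G x" using nS by blast
        ultimately show ?thesis by (simp add: nbrs_def)
      qed (simp add: G'_def)
    qed
    have "verts G = verts G' \<union> verts K" using SV TV by (auto simp: vG' K_def U_def)
    with edges have Geq: "G = (verts G' \<union> verts K, edges G' \<union> edges K)" by (simp add: prod_eq_iff)
    have isoK: "graph_iso K (complete_bipartite (card S) (card S))"
      unfolding K_def using fin SV TV disj cST
      by (intro graph_iso_complete_bipartite) (auto intro: finite_subset)
    have PG': "edges G' \<subseteq> Pow (verts G')" and PK: "edges K \<subseteq> Pow (verts K)" and dK: "verts G' \<inter> verts K = {}"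
      by (auto simp: G'_def K_def U_def)
    note join = graph_iso_join[OF PG' PK dK IH, folded Geq]
    \<comment> \<open>The degree of v decides which of the two families gains a copy.\<close>
    consider "card S = a" | "card S = Suc a" using less.prems(5)[OF v] by (auto simp: S_def)
    then show ?thesis
    proof cases
      case 1
      have "graph_iso K (relabel (\<lambda>x. Inl (l1, x) :: nat \<times> (nat + nat) + nat \<times> (nat + nat)) (complete_bipartite a a))"
        using isoK unfolding 1 by (rule graph_iso_trans) (intro graph_iso_relabel inj_onI, simp)
      from join[OF this bipartite_union_Suc1(2)] have "graph_iso G (bipartite_union (Suc l1) l2 a)"
        by (simp add: bipartite_union_Suc1(1))
      then show ?thesis by blast
    next
      case 2
      have "graph_iso K (relabel (\<lambda>x. Inr (l2, x) :: nat \<times> (nat + nat) + nat \<times> (nat + nat)) (complete_bipartite (a + 1) (a + 1)))"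
        using isoK unfolding 2 Suc_eq_plus1 by (rule graph_iso_trans) (intro graph_iso_relabel inj_onI, simp)
      from join[OF this bipartite_union_Suc2(2)] have "graph_iso G (bipartite_union l1 (Suc l2) a)"
        by (simp only: bipartite_union_Suc2(1))
      then show ?thesis by blast
    qed
  qed
qed

section \<open>The extremal graphs\<close>

lemma bipartite_union_params:
  assumes "graph_iso G (bipartite_union l1 l2 r)" "G \<in> simple_graphs (2 * n) m"
  shows "n = l1 * r + l2 * (r + 1)" "m = l1 * r\<^sup>2 + l2 * (r + 1)\<^sup>2"
proof -
  have "bipartite_union l1 l2 r \<in> simple_graphs (2 * n) m"
    using assms by (rule graph_iso_simple_graphs)
  with bipartite_union_simple[of l1 l2 r]
  have "2 * n = 2 * (l1 * r + l2 * (r + 1))" "m = l1 * r\<^sup>2 + l2 * (r + 1)\<^sup>2"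
    unfolding simple_graphs_iff by linarith+
  then show "n = l1 * r + l2 * (r + 1)" "m = l1 * r\<^sup>2 + l2 * (r + 1)\<^sup>2" by simp_all
qed

text \<open>Since m = n r + l2 (r + 1), and l1 >= 1 makes l2 (r + 1) smaller than n, this is
  division with remainder. Without l1 >= 1, copies of a single K_{s,s} could be read with r = s or
  with r = s - 1.\<close>

lemma bipartite_params_div_mod:
  fixes n m l1 l2 r :: nat
  assumes "1 \<le> r" "1 \<le> l1" and n: "n = l1 * r + l2 * (r + 1)" and m: "m = l1 * r\<^sup>2 + l2 * (r + 1)\<^sup>2"
  shows "m div n = r" "m mod n = l2 * (r + 1)"
proof -
  have mn: "m = n * r + l2 * (r + 1)" unfolding n m by (simp add: power2_eq_square algebra_simps)
  have "0 < l1 * r" using assms by simp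
  then have lt: "l2 * (r + 1) < n" unfolding n by linarith
  show "m div n = r" unfolding mn using lt by (simp add: div_mult_self1_is_m)
  show "m mod n = l2 * (r + 1)" unfolding mn using lt by simp
qed

lemma bipartite_params_unique:
  fixes n m :: nat
  assumes "1 \<le> r" "1 \<le> l1" "n = l1 * r + l2 * (r + 1)" "m = l1 * r\<^sup>2 + l2 * (r + 1)\<^sup>2"
    and "1 \<le> s" "1 \<le> k1" "n = k1 * s + k2 * (s + 1)" "m = k1 * s\<^sup>2 + k2 * (s + 1)\<^sup>2"
  shows "s = r \<and> k1 = l1 \<and> k2 = l2"
proof -
  note l = bipartite_params_div_mod[OF assms(1-4)] and k = bipartite_params_div_mod[OF assms(5-8)]
  have s: "s = r" using l(1) k(1) by simp
  have "l2 * (r + 1) = k2 * (r + 1)" using l(2) k(2) s by simp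
  then have k2: "k2 = l2" by (simp only: mult_cancel2) simp
  have "k1 * r = l1 * r" using assms(3,7) s k2 by simp
  then show ?thesis using s k2 assms(1) by simp
qed

text \<open>Here \<alpha> = l2 (r + 1) and n - \<alpha> = l1 r, so the exponents in
  \<open>omega\<close> become the integers l1 and l2.\<close>

lemma omega_bipartite:
  assumes "1 \<le> r" "1 \<le> l1" "n = l1 * r + l2 * (r + 1)" "m = l1 * r\<^sup>2 + l2 * (r + 1)\<^sup>2" "0 < n" "n \<le> m"
  shows "omega n m = real (fact r ^ l1 * fact (r + 1) ^ l2)"
proof -
  note d = bipartite_params_div_mod[OF assms(1-4)]
  have "real m = real n * real r + real (l2 * (r + 1))"
    using d by (metis mult_div_mod_eq of_nat_add of_nat_mult)
  then have a: "real m - real n * real r = real l2 * real (Suc r)" by (simp add: algebra_simps)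
  have n: "real n = real l1 * real r + real l2 * real (Suc r)" using assms(3) by (simp add: algebra_simps)
  have "real n * ln_fact_root r + (real m - real n * real r) * (ln_fact_root (Suc r) - ln_fact_root r) =
      real l1 * (real r * ln_fact_root r) + real l2 * (real (Suc r) * ln_fact_root (Suc r))"
    unfolding a by (subst n) (simp only: algebra_simps)
  then have "omega n m = exp (real l1 * ln (fact r) + real l2 * ln (fact (Suc r)))"
    using omega_eq_exp[OF assms(5,6)] d(1) by (simp only: real_mult_lf)
  also have "\<dots> = fact r ^ l1 * fact (Suc r) ^ l2"
    by (simp only: exp_add exp_of_nat_mult exp_ln fact_gt_zero)
  finally show ?thesis by (simp only: of_nat_mult of_nat_power of_nat_fact Suc_eq_plus1)
qed

lemma perfmat_eq_omega_imp_bipartite_union: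
  assumes G: "G \<in> simple_graphs (2 * n) m" and nm: "0 < n" "n \<le> m" and eq: "real (perfmat G) = omega n m"
  shows "\<exists>r l1 l2. 1 \<le> r \<and> 1 \<le> l1 \<and> graph_iso G (bipartite_union l1 l2 r)"
proof -
  define a where "a = m div n"
  have a: "0 < a" using nm by (simp add: a_def div_greater_zero_iff)
  have G': "fin_graph G" "card (verts G) = 2 * n" "card (edges G) = m"
    using G by (simp_all add: simple_graphs_iff)
  have "0 < omega n m" using omega_eq_exp[OF nm] by simp
  then have pos: "0 < perfmat G" using eq by simp
  have prod: "(\<Prod>v\<in>verts G. degree_factor (degree G v)) = omega n m"
    using kahn_lovasz(1)[OF G'(1)] degree_product_le_omega(1)[OF G' nm] eq by simp
  have blocks: "blocks G" using kahn_lovasz(2)[OF G'(1) pos] eq prod by simp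
  have "almost_regular G" using degree_product_le_omega(2)[OF G' nm] prod by simp
  then have deg: "\<forall>v\<in>verts G. degree G v = a \<or> degree G v = Suc a"
    using almost_regular_iff[OF G'(1) nm(1) G'(2,3)] by (simp add: a_def)
  have "\<exists>l1 l2. graph_iso G (bipartite_union l1 l2 a)"
  proof (rule blocks_imp_bipartite_union[OF G'(1) blocks a])
    show "card (nbrs G u) = card (nbrs G v)" if "u \<in> nbrs G v" for u v
      by (rule placement_imp_nbr_degree_eq[OF G'(1) blocks perfmat_pos_imp_placement[OF G'(1) pos] that])
    show "card (nbrs G v) = a \<or> card (nbrs G v) = Suc a" if "v \<in> verts G" for v
      using deg that by (simp add: degree_eq_card_nbrs[OF G'(1)])
  qed
  then obtain l1 l2 where iso: "graph_iso G (bipartite_union l1 l2 a)" by blast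
  \<comment> \<open>Otherwise m = n (a + 1), contradicting a = m div n.\<close>
  have "l1 \<noteq> 0"
  proof
    assume "l1 = 0"
    then have "n = l2 * (a + 1)" "m = l2 * (a + 1)\<^sup>2"
      using bipartite_union_params[OF iso G] by simp_all
    then have "m = n * (a + 1)" by (simp add: power2_eq_square algebra_simps)
    then have "a = a + 1" using nm(1) unfolding a_def by (metis nonzero_mult_div_cancel_left not_gr_zero)
    then show False by simp
  qed
  with iso a show ?thesis by (intro exI[of _ a] exI[of _ l1] exI[of _ l2]) simp
qed

lemma perfmat_le_omega:
  assumes G: "G \<in> simple_graphs (2 * n) m" and nm: "0 < n" "n \<le> m"
  shows "real (perfmat G) \<le> omega n m"
proof -
  have G': "fin_graph G" "card (verts G) = 2 * n" "card (edges G) = m"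
    using G by (simp_all add: simple_graphs_iff)
  show ?thesis using kahn_lovasz(1)[OF G'(1)] degree_product_le_omega(1)[OF G' nm] by linarith
qed

lemma bipartite_union_perfmat_eq_omega:
  assumes G: "G \<in> simple_graphs (2 * n) m" and nm: "0 < n" "n \<le> m"
    and r: "1 \<le> r" "1 \<le> l1" and iso: "graph_iso G (bipartite_union l1 l2 r)"
  shows "real (perfmat G) = omega n m"
proof (rule antisym)
  show "real (perfmat G) \<le> omega n m" by (rule perfmat_le_omega[OF G nm])
  have "perfmat G = perfmat (bipartite_union l1 l2 r)"
    using G iso by (intro perfmat_iso) (simp_all add: simple_graphs_iff)
  then have "fact r ^ l1 * fact (r + 1) ^ l2 \<le> perfmat G"
    using perfmat_bipartite_union_ge[of r l1 l2] by simp
  then show "omega n m \<le> real (perfmat G)"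
    unfolding omega_bipartite[OF r bipartite_union_params[OF iso G] nm] by (simp only: of_nat_le_iff)
qed

lemma exists_bipartite_union:
  fixes n m :: nat
  assumes "n = l1 * r + l2 * (r + 1)" "m = l1 * r\<^sup>2 + l2 * (r + 1)\<^sup>2"
  shows "\<exists>G \<in> (simple_graphs (2 * n) m :: nat sgraph set). graph_iso G (bipartite_union l1 l2 r)"
proof -
  have B: "bipartite_union l1 l2 r \<in> simple_graphs (2 * n) m"
    using bipartite_union_simple[of l1 l2 r] assms by simp
  obtain H :: "nat sgraph" where H: "H \<in> simple_graphs (2 * n) m" "graph_iso (bipartite_union l1 l2 r) H"
    using exists_nat_copy[OF B] by blast
  have "graph_iso H (bipartite_union l1 l2 r)"
    using B by (intro graph_iso_sym[OF _ H(2)]) (simp add: simple_graphs_iff)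
  with H(1) show ?thesis by blast
qed

text \<open>Existence claims are made over \<open>nat\<close>, which has room for every finite
  graph; a type \<open>'a\<close> may have fewer than 2n elements. Claims about all graphs hold over
  any \<open>'a\<close>, and isomorphism invariance links both to \<open>mu\<close>.\<close>

theorem theorem4:
  fixes n m :: nat
  assumes "0 < n" and "0 < m" and "n \<le> m" and "m \<le> (2 * n) choose 2"
  shows
    "(\<forall>G \<in> (simple_graphs (2 * n) m :: 'a sgraph set).
        (\<Prod>v\<in>verts G. degree_factor (degree G v)) \<le> omega n m \<and>
        ((\<Prod>v\<in>verts G. degree_factor (degree G v)) = omega n m \<longleftrightarrow> almost_regular G)) \<and>

     (real (mu n m) \<le> omega n m \<and>
      (real (mu n m) = omega n m \<longleftrightarrow>
        (\<exists>G \<in> (simple_graphs (2 * n) m :: nat sgraph set).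
         \<exists>n1 l1 l2. 1 \<le> n1 \<and> 1 \<le> l1 \<and> graph_iso G (bipartite_union l1 l2 n1))) \<and>
      (\<forall>n1 l1 l2. 1 \<le> n1 \<and> 1 \<le> l1 \<longrightarrow>
        ((\<exists>G \<in> (simple_graphs (2 * n) m :: nat sgraph set). graph_iso G (bipartite_union l1 l2 n1)) \<longleftrightarrow>
         n = l1 * n1 + l2 * (n1 + 1) \<and> m = l1 * n1\<^sup>2 + l2 * (n1 + 1)\<^sup>2))) \<and>

     (\<forall>n1 l1 l2. 1 \<le> n1 \<and> 1 \<le> l1 \<and>
          n = l1 * n1 + l2 * (n1 + 1) \<and> m = l1 * n1\<^sup>2 + l2 * (n1 + 1)\<^sup>2 \<longrightarrow>
        (\<exists>G \<in> (simple_graphs (2 * n) m :: nat sgraph set). perfmat G = mu n m) \<and>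
        (\<forall>G \<in> (simple_graphs (2 * n) m :: 'a sgraph set).
         \<forall>H \<in> (simple_graphs (2 * n) m :: 'a sgraph set).
           perfmat G = mu n m \<and> perfmat H = mu n m \<longrightarrow> graph_iso G H) \<and>
        (\<forall>G \<in> (simple_graphs (2 * n) m :: 'a sgraph set).
           perfmat G = mu n m \<longleftrightarrow> graph_iso G (bipartite_union l1 l2 n1)))"
proof -
  note nm = assms(1,3)
  obtain G0 :: "nat sgraph" where G0: "G0 \<in> simple_graphs (2 * n) m" "perfmat G0 = mu n m"
    using mu_attained[OF assms(4)] by blast
  have mu_le: "real (mu n m) \<le> omega n m"
    using perfmat_le_omega[OF G0(1) nm] G0(2) by simp
  have mu_eq: "real (mu n m) = omega n m"
    if G: "G \<in> (simple_graphs (2 * n) m :: nat sgraph set)" and r: "1 \<le> r" "1 \<le> l1"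
      and iso: "graph_iso G (bipartite_union l1 l2 r)" for G r l1 l2
  proof (rule antisym[OF mu_le])
    have "omega n m = real (perfmat G)"
      by (rule bipartite_union_perfmat_eq_omega[OF G nm r iso, symmetric])
    also have "\<dots> \<le> real (mu n m)" using perfmat_le_mu[OF G] by simp
    finally show "omega n m \<le> real (mu n m)" .
  qed
  have part1: "(\<Prod>v\<in>verts G. degree_factor (degree G v)) \<le> omega n m \<and>
      ((\<Prod>v\<in>verts G. degree_factor (degree G v)) = omega n m \<longleftrightarrow> almost_regular G)"
    if "G \<in> (simple_graphs (2 * n) m :: 'a sgraph set)" for G
    using degree_product_le_omega[of G n m] nm that by (simp add: simple_graphs_iff)
  have part2: "real (mu n m) = omega n m \<longleftrightarrow>
        (\<exists>G \<in> (simple_graphs (2 * n) m :: nat sgraph set).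
         \<exists>n1 l1 l2. 1 \<le> n1 \<and> 1 \<le> l1 \<and> graph_iso G (bipartite_union l1 l2 n1))"
    using perfmat_eq_omega_imp_bipartite_union[OF G0(1) nm] G0 mu_eq by metis
  have params: "(\<exists>G \<in> (simple_graphs (2 * n) m :: nat sgraph set). graph_iso G (bipartite_union l1 l2 n1)) \<longleftrightarrow>
         n = l1 * n1 + l2 * (n1 + 1) \<and> m = l1 * n1\<^sup>2 + l2 * (n1 + 1)\<^sup>2" for n1 l1 l2
  proof
    assume "\<exists>G \<in> (simple_graphs (2 * n) m :: nat sgraph set). graph_iso G (bipartite_union l1 l2 n1)"
    then obtain G :: "nat sgraph" where "G \<in> simple_graphs (2 * n) m" "graph_iso G (bipartite_union l1 l2 n1)"
      by blast
    then show "n = l1 * n1 + l2 * (n1 + 1) \<and> m = l1 * n1\<^sup>2 + l2 * (n1 + 1)\<^sup>2"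
      using bipartite_union_params by blast
  next
    assume "n = l1 * n1 + l2 * (n1 + 1) \<and> m = l1 * n1\<^sup>2 + l2 * (n1 + 1)\<^sup>2"
    then show "\<exists>G \<in> (simple_graphs (2 * n) m :: nat sgraph set). graph_iso G (bipartite_union l1 l2 n1)"
      by (elim conjE) (rule exists_bipartite_union)
  qed
  have extremal: "perfmat G = mu n m \<longleftrightarrow> graph_iso G (bipartite_union l1 l2 r)"
    if r: "1 \<le> r" "1 \<le> l1" "n = l1 * r + l2 * (r + 1)" "m = l1 * r\<^sup>2 + l2 * (r + 1)\<^sup>2"
      and G: "G \<in> (simple_graphs (2 * n) m :: 'a sgraph set)" for r l1 l2 G
  proof -
    have eq: "real (mu n m) = omega n m"
      using exists_bipartite_union[OF r(3,4)] mu_eq r(1,2) by blast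
    show ?thesis
    proof
      assume "perfmat G = mu n m"
      then have "real (perfmat G) = omega n m" using eq by simp
      from perfmat_eq_omega_imp_bipartite_union[OF G nm this]
      obtain s k1 k2 where s: "1 \<le> s" "1 \<le> k1" "graph_iso G (bipartite_union k1 k2 s)" by blast
      have "s = r \<and> k1 = l1 \<and> k2 = l2"
        by (rule bipartite_params_unique[OF r s(1,2) bipartite_union_params[OF s(3) G]])
      with s(3) show "graph_iso G (bipartite_union l1 l2 r)" by simp
    next
      assume "graph_iso G (bipartite_union l1 l2 r)"
      from bipartite_union_perfmat_eq_omega[OF G nm r(1,2) this] eq
      show "perfmat G = mu n m" by simp
    qed
  qed
  have unique: "graph_iso G H"
    if "1 \<le> r" "1 \<le> l1" "n = l1 * r + l2 * (r + 1)" "m = l1 * r\<^sup>2 + l2 * (r + 1)\<^sup>2"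
      and G: "G \<in> (simple_graphs (2 * n) m :: 'a sgraph set)" "H \<in> (simple_graphs (2 * n) m :: 'a sgraph set)"
      and "perfmat G = mu n m" "perfmat H = mu n m" for r l1 l2 G H
  proof -
    have "graph_iso G (bipartite_union l1 l2 r)" "graph_iso H (bipartite_union l1 l2 r)"
      using extremal[OF that(1-4)] that(5-8) by blast+
    moreover have "fin_graph H" using G(2) by (simp add: simple_graphs_iff)
    ultimately show ?thesis using graph_iso_sym graph_iso_trans by blast
  qed
  show ?thesis
  proof (intro conjI allI ballI impI, goal_cases)
    case (1 G)
    then show ?case using part1 by simp
  next
    case (2 G)
    then show ?case using part1 by simp
  next
    case 3
    show ?case by (rule mu_le)
  next
    case 4
    show ?case by (rule part2)
  next
    case (5 n1 l1 l2)
    show ?case by (rule params)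
  next
    case (6 n1 l1 l2)
    show ?case by (rule mu_attained[OF assms(4)])
  next
    case (7 n1 l1 l2 G H)
    then show ?case by (elim conjE) (rule unique)
  next
    case (8 n1 l1 l2 G)
    then show ?case by (elim conjE) (rule extremal)
  qed
qed

end
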